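(* Let $(\alpha,\rho)\in\mathcal{A}$ and let $X_{\alpha,\rho}$ be a real random variable with the free stable distribution $\nu_{\alpha,\rho}$. Then for every $s\in(-1,\alpha)$ $$\mathbb{E}\left[(X_{\alpha,\rho})^s\,\mathbf{1}_{\{X_{\alpha,\rho}>0\}}\right]=\frac{1}{\pi}\sin(\pi\rho s)\,\frac{\Gamma(s)\,\Gamma(1-s/\alpha)}{\Gamma(2+s-s/\alpha)},$$ where at $s=0$ the right-hand side is understood as its limit as $s\to 0$.
   Context: The set of admissible parameters is $$\mathcal{A}=\{(\alpha,\rho):\alpha\in(0,1),\ \rho\in[0,1]\}\cup\{(\alpha,\rho):\alpha\in(1,2],\ \rho\in[1-\alpha^{-1},\alpha^{-1}]\}.$$ All powers use the principal branch. For $(\alpha,\rho)\in\mathcal{A}$, the free stable distribution $\nu_{\alpha,\rho}$ is the probability measure on $\mathbb{R}$ (known to exist and be unique) whose Voiculescu transform is $\phi_{\alpha,\rho}(z)=-e^{\pi i\alpha\rho}z^{-\alpha+1}$ for $\operatorname{Im}(z)>0$. This means that its Cauchy transform $G_{\alpha,\rho}(z)=\int_{\mathbb{R}}\frac{\nu_{\alpha,\rho}(dx)}{z-x}$, $\operatorname{Im}(z)>0$ (which takes values in the lower half-plane), is the inverse function of $w\mapsto \frac1w+\phi_{\alpha,\rho}(\frac1w)$, i.e. $w=G_{\alpha,\rho}(z)$ satisfies $z=w^{-1}-e^{\pi i\alpha\rho}w^{\alpha-1}$ for all $z$ with $\operatorname{Im}(z)>0$. *)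

theory Defs
  imports "HOL-Probability.Probability"
begin

definition admissible :: "(real \<times> real) set" where
  "admissible = {(\<alpha>, \<rho>). \<alpha> \<in> {0<..<1} \<and> \<rho> \<in> {0..1}}
     \<union> {(\<alpha>, \<rho>). \<alpha> \<in> {1<..2} \<and> \<rho> \<in> {1 - inverse \<alpha>..inverse \<alpha>}}"

definition cauchy_transform :: "real measure \<Rightarrow> complex \<Rightarrow> complex" where
  "cauchy_transform \<nu> z = (LINT x|\<nu>. 1 / (z - complex_of_real x))"

text \<open>
  \<open>has_voiculescu_transform \<nu> \<phi>\<close> says that the Voiculescu transform of \<open>\<nu>\<close>, which in general is only
  defined on a truncated cone, continues to \<open>\<phi>\<close> on the whole upper half-plane. Equivalently, \<open>\<phi>\<close> is
  holomorphic there and \<open>w \<mapsto> 1/w + \<phi> (1/w)\<close> inverts the Cauchy transform \<open>w = G z\<close> for all \<open>z\<close> with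
  \<open>Im z > 0\<close>. For a probability measure \<open>\<nu>\<close>, \<open>G z\<close> lies in the lower half-plane, so \<open>1 / G z\<close> lies in
  the upper half-plane. For \<open>\<phi>\<close> as in \<open>free_stable_phi\<close> the equation reads
  \<open>z = 1/w - exp (i \<pi> \<alpha> \<rho>) w powr (\<alpha> - 1)\<close>.
\<close>
definition has_voiculescu_transform :: "real measure \<Rightarrow> (complex \<Rightarrow> complex) \<Rightarrow> bool" where
  "has_voiculescu_transform \<nu> \<phi> \<longleftrightarrow>
     \<phi> holomorphic_on {z. Im z > 0} \<and>
     (\<forall>z. Im z > 0 \<longrightarrow>
        1 / cauchy_transform \<nu> z + \<phi> (1 / cauchy_transform \<nu> z) = z)"

definition free_stable_phi :: "real \<Rightarrow> real \<Rightarrow> complex \<Rightarrow> complex" where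
  "free_stable_phi \<alpha> \<rho> z =
     - exp (complex_of_real pi * \<i> * complex_of_real \<alpha> * complex_of_real \<rho>)
       * z powr complex_of_real (- \<alpha> + 1)"

definition is_free_stable :: "real \<Rightarrow> real \<Rightarrow> real measure \<Rightarrow> bool" where
  "is_free_stable \<alpha> \<rho> \<nu> \<longleftrightarrow>
     prob_space \<nu> \<and> sets \<nu> = sets borel \<and>
     has_voiculescu_transform \<nu> (free_stable_phi \<alpha> \<rho>)"

definition moment_formula :: "real \<Rightarrow> real \<Rightarrow> real \<Rightarrow> real" where
  "moment_formula \<alpha> \<rho> s =
     1 / pi * sin (pi * \<rho> * s) * (Gamma s * Gamma (1 - s / \<alpha>) / Gamma (2 + s - s / \<alpha>))"

end

theory Submission
  imports Defs "HOL-Complex_Analysis.Complex_Analysis"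
begin

text \<open>
  Write \<open>\<omega> = cis (\<pi>\<rho>)\<close>, let \<open>G\<close> be the Cauchy transform and \<open>F = 1 / G\<close>. The defining equation says
  \<open>F z - cis (\<pi>\<alpha>\<rho>) (F z) powr (1 - \<alpha>) = z\<close>. On the ray \<open>z = \<omega> y\<close> with \<open>y > 0\<close> the phases match: \<open>F z = \<omega> r\<close>
  solves it as soon as the real number \<open>r > 1\<close> solves \<open>r - r powr (1 - \<alpha>) = y\<close>. For
  admissible \<open>\<rho>\<close> no other point of the upper half-plane solves it (\<open>angle_eq_zero_on_ray\<close>), so the
  values of \<open>F\<close> on the ray are read off from the equation itself. With \<open>u = r powr (- \<alpha>)\<close> the
  ray is parametrised by \<open>u \<in> (0, 1)\<close>: \<open>y = u powr (- 1 / \<alpha>) (1 - u)\<close> and \<open>\<omega> G (\<omega> y) = u powr (1 / \<alpha>)\<close>.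

  For \<open>-1 < s < 0\<close> the Mellin integral \<open>\<integral> y powr s \<omega> G (\<omega> y) dy\<close> is then computed in two ways. Substituting
  \<open>u\<close> for \<open>y\<close> turns it into Beta integrals, which add up to the Gamma quotient of the moment formula
  (\<open>mellin_ray_param\<close>). On the other hand \<open>\<omega> G (\<omega> y)\<close> is the expectation of \<open>1 / (y - X / \<omega>)\<close>, and
  exchanging the integrals leaves the Stieltjes kernel
  \<open>\<integral> y powr s / (y + z) dy = - \<pi> / sin (\<pi> s) * z powr s\<close> at \<open>z = - X / \<omega>\<close> (\<open>stieltjes_kernel\<close>). After
  multiplication by \<open>\<omega> powr s\<close> the contribution of a negative value of \<open>X\<close> is real, whereas that of a positive
  value has imaginary part \<open>- \<pi> X powr s\<close>. Comparing imaginary parts isolates the moment over \<open>X > 0\<close>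
  (\<open>mellin_from_ray\<close>).

  When \<open>\<rho> \<in> {0, 1}\<close>, which forces \<open>\<alpha> < 1\<close>, the ray lies on the real axis, on the boundary of
  the domain of the functional equation. There the imaginary part of \<open>G\<close> is shown to vanish at the boundary on the
  half-line \<open>\<omega> y\<close>, \<open>y > 0\<close>. Hence \<open>X\<close> puts no mass on that half-line, and \<open>G\<close> extends to it by
  continuity. For \<open>\<rho> = 0\<close> this makes every moment over \<open>X > 0\<close> zero; for \<open>\<rho> = 1\<close> the argument above
  applies on the negative half-line.

  The range \<open>0 \<le> s < \<alpha>\<close> is reached by an argument of Landau type. The right-hand side is holomorphic on the strip
  \<open>-1 < Re s < \<alpha>\<close>, and a Laplace transform with nonnegative weight cannot stop converging at a real point
  where its values continue holomorphically (\<open>laplace_transform_extension\<close>). At \<open>s = 0\<close> the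
  continuation takes the value \<open>\<rho>\<close>, the limit of the formula.
\<close>

section \<open>The Mellin transform along the ray\<close>

text \<open>
  With \<open>r = u powr (- 1 / \<alpha>)\<close> this is \<open>r - r powr (1 - \<alpha>)\<close>, the position on the ray at which the reciprocal
  Cauchy transform has modulus \<open>r\<close>. The parameter \<open>u \<in> (0, 1)\<close> is chosen so that the Mellin transform becomes
  a Beta integral.
\<close>

definition ray_param :: "real \<Rightarrow> real \<Rightarrow> real" where
  "ray_param \<alpha> u = u powr (- 1 / \<alpha>) * (1 - u)"

lemma ray_param_pos: "0 < u \<Longrightarrow> u < 1 \<Longrightarrow> 0 < ray_param \<alpha> u"
  by (simp add: ray_param_def)

lemma ray_param_strict_antimono:
  assumes "0 < \<alpha>" "0 < u" "u < v" "v < 1"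
  shows "ray_param \<alpha> v < ray_param \<alpha> u"
proof -
  have "v powr (- 1 / \<alpha>) \<le> u powr (- 1 / \<alpha>)"
    using assms by (intro powr_mono2') auto
  then show ?thesis
    unfolding ray_param_def using assms by (intro mult_le_less_imp_less) auto
qed

lemma inj_on_ray_param: "0 < \<alpha> \<Longrightarrow> inj_on (ray_param \<alpha>) {0<..<1}"
  by (rule linorder_inj_onI') (use ray_param_strict_antimono[of \<alpha>] in force)

lemma ray_param_deriv:
  assumes "0 < \<alpha>" "0 < u"
  shows "(ray_param \<alpha> has_field_derivative
            - (u powr (- 1 / \<alpha>) * ((1 - u) / (\<alpha> * u) + 1))) (at u within S)"
proof -
  have "u powr (- 1 / \<alpha> - 1) = u powr (- 1 / \<alpha>) / u"
    using assms by (simp add: powr_diff)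
  then have "((\<lambda>u. u powr (- 1 / \<alpha>) * (1 - u)) has_field_derivative
     - (u powr (- 1 / \<alpha>) * ((1 - u) / (\<alpha> * u) + 1))) (at u within S)"
    using assms by (auto intro!: derivative_eq_intros simp: field_simps)
  then show ?thesis by (simp add: ray_param_def[abs_def])
qed

lemma Beta_real_set_integral:
  assumes "a > 0" "b > (0::real)"
  shows "set_integrable lborel {0<..<1} (\<lambda>t. t powr (a - 1) * (1 - t) powr (b - 1))"
    and "(LBINT t:{0<..<1}. t powr (a - 1) * (1 - t) powr (b - 1)) = Beta a b"
proof -
  let ?f = "\<lambda>t::real. t powr (a - 1) * (1 - t) powr (b - 1)"
  have I: "set_integrable lborel {0..1} ?f" by (rule integrable_Beta) fact+
  show "set_integrable lborel {0<..<1} ?f"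
    by (rule set_integrable_subset[OF I]) auto
  have "(LBINT t:{0<..<1}. ?f t) = (LBINT t:{0..1}. ?f t)"
    unfolding set_lebesgue_integral_def
    by (intro Bochner_Integration.integral_cong refl) (auto simp: indicator_def)
  also have "\<dots> = integral {0..1} ?f"
    using set_borel_integral_eq_integral(2)[OF I] .
  also have "\<dots> = Beta a b"
    using has_integral_Beta_real[OF assms] by blast
  finally show "(LBINT t:{0<..<1}. ?f t) = Beta a b" .
qed

text \<open>
  The change of variables \<open>y = ray_param \<alpha> u\<close> produces two Beta integrals, because the derivative
  of \<open>ray_param \<alpha>\<close> has two terms. They combine into a single Gamma quotient through the functional equation of
  \<open>Gamma\<close>. Besides free stable laws, this covers \<open>q y = 1 / (y + 1)\<close>, which is the case \<open>\<alpha> = 1\<close>.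
\<close>

lemma mellin_ray_param:
  fixes q :: "real \<Rightarrow> real"
  assumes \<alpha>: "0 < \<alpha>" and s: "-1 < s" "s < 0"
    and q [measurable]: "q \<in> borel_measurable borel"
    and q_eq: "\<And>u. 0 < u \<Longrightarrow> u < 1 \<Longrightarrow> q (ray_param \<alpha> u) = u powr (1 / \<alpha>)"
    and surj: "\<And>y. 0 < y \<Longrightarrow> \<exists>u. 0 < u \<and> u < 1 \<and> ray_param \<alpha> u = y"
  shows "set_integrable lborel {0<..} (\<lambda>y. y powr s * q y)"
    and "(LBINT y:{0<..}. y powr s * q y) = - (Gamma s * Gamma (1 - s / \<alpha>) / Gamma (2 + s - s / \<alpha>))"
proof -
  define S where "S = {0<..<1::real}"
  define h where "h u = - (u powr (- 1 / \<alpha>) * ((1 - u) / (\<alpha> * u) + 1))" for u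
  define a where "a = - s / \<alpha>"
  define k where "k u = (1 / \<alpha>) * (u powr (a - 1) * (1 - u) powr ((s + 2) - 1))
      + u powr ((a + 1) - 1) * (1 - u) powr ((s + 1) - 1)" for u
  have a: "a > 0" using \<alpha> s by (simp add: a_def divide_neg_pos)
  have image: "ray_param \<alpha> ` S = {0<..}"
    using surj ray_param_pos by (fastforce simp: S_def image_iff)
  have integrand: "\<bar>h u\<bar> * (ray_param \<alpha> u powr s * q (ray_param \<alpha> u)) = k u" if "u \<in> S" for u
  proof -
    have u: "0 < u" "u < 1" using that by (auto simp: S_def)
    have "\<bar>h u\<bar> = u powr (- 1 / \<alpha>) * ((1 - u) / (\<alpha> * u) + 1)"
      using u \<alpha> by (simp add: h_def abs_mult)
    moreover have "ray_param \<alpha> u powr s = u powr a * (1 - u) powr s"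
      using u by (simp add: ray_param_def powr_mult powr_powr a_def)
    ultimately have "\<bar>h u\<bar> * (ray_param \<alpha> u powr s * q (ray_param \<alpha> u))
        = (u powr (- 1 / \<alpha>) * u powr (1 / \<alpha>)) * (((1 - u) / (\<alpha> * u) + 1) * (u powr a * (1 - u) powr s))"
      using u by (simp add: q_eq mult_ac)
    also have "u powr (- 1 / \<alpha>) * u powr (1 / \<alpha>) = 1"
      using u by (simp flip: powr_add)
    also have "1 * (((1 - u) / (\<alpha> * u) + 1) * (u powr a * (1 - u) powr s)) = k u"
    proof -
      have "u powr (a - 1) = u powr a / u" "(1 - u) powr ((s + 2) - 1) = (1 - u) powr s * (1 - u)"
        using u powr_add[of "1 - u" s 1] by (simp_all add: powr_diff add.commute)
      moreover have "((1 - u) / (\<alpha> * u) + 1) * (A * B) = 1 / \<alpha> * (A / u * (B * (1 - u))) + A * B" for A B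
        using u \<alpha> by (simp add: field_simps)
      ultimately show ?thesis
        unfolding k_def by (simp del: add_diff_eq)
    qed
    finally show ?thesis .
  qed
  have k_int: "set_integrable lborel S k"
    and k_val: "(LBINT u:S. k u) = (1 / \<alpha>) * Beta a (s + 2) + Beta (a + 1) (s + 1)"
    unfolding k_def S_def using Beta_real_set_integral[of a "s+2"] Beta_real_set_integral[of "a+1" "s+1"] a s
    by (simp_all add: set_integral_add set_integrable_mult_right)
  have beta_sum: "(1 / \<alpha>) * Beta a (s + 2) + Beta (a + 1) (s + 1)
      = - (Gamma s * Gamma (1 - s / \<alpha>) / Gamma (2 + s - s / \<alpha>))"
  proof -
    have G: "Gamma (a + 1) = a * Gamma a" "Gamma (s + 2) = (s + 1) * Gamma (s + 1)"
      "Gamma (s + 1) = s * Gamma s"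
    proof -
      have "a \<notin> \<int>\<^sub>\<le>\<^sub>0" "s + 1 \<notin> \<int>\<^sub>\<le>\<^sub>0" using a s by (auto elim!: nonpos_Ints_cases)
      moreover have "s \<notin> \<int>\<^sub>\<le>\<^sub>0"
      proof
        assume "s \<in> \<int>\<^sub>\<le>\<^sub>0"
        then obtain n where "s = of_int n" by (auto elim!: nonpos_Ints_cases)
        with s have "-1 < n" "n < 0" by simp_all
        then show False by simp
      qed
      ultimately show "Gamma (a + 1) = a * Gamma a" "Gamma (s + 2) = (s + 1) * Gamma (s + 1)"
        "Gamma (s + 1) = s * Gamma s"
        using Gamma_plus1[of a] Gamma_plus1[of "s + 1"] Gamma_plus1[of s] by (simp_all add: add.assoc)
    qed
    have D: "a + (s + 2) = 2 + s - s / \<alpha>" "a + 1 + (s + 1) = 2 + s - s / \<alpha>" "1 - s / \<alpha> = a + 1"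
      by (simp_all add: a_def)
    have "(1 / \<alpha>) * Beta a (s + 2) + Beta (a + 1) (s + 1)
        = Gamma a * Gamma s / Gamma (2 + s - s / \<alpha>) * ((s + 1) * (s / \<alpha>) + a * s)"
      unfolding Beta_def D G by (simp add: distrib_left add_divide_distrib mult_ac)
    also have "(s + 1) * (s / \<alpha>) + a * s = - a"
      by (simp add: a_def algebra_simps add_divide_distrib)
    finally show ?thesis
      by (simp add: D G)
  qed
  have S: "S \<in> sets lebesgue" by (simp add: S_def)
  have der: "(ray_param \<alpha> has_field_derivative h x) (at x within S)" if "x \<in> S" for x
    unfolding h_def using that \<alpha> by (intro ray_param_deriv) (auto simp: S_def)
  have inj: "inj_on (ray_param \<alpha>) S"
    using \<alpha> by (simp add: S_def inj_on_ray_param)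
  have k_leb: "set_integrable lebesgue S k"
    using k_int unfolding set_integrable_def
    by (subst integrable_completion) (auto simp: S_def k_def)
  have k_cong: "set_integrable lebesgue S (\<lambda>u. \<bar>h u\<bar> * (ray_param \<alpha> u powr s * q (ray_param \<alpha> u)))"
    using k_leb by (rule set_integrable_cong[THEN iffD2, rotated -1]) (auto simp: integrand)
  have "integral S (\<lambda>u. \<bar>h u\<bar> * (ray_param \<alpha> u powr s * q (ray_param \<alpha> u))) = integral S k"
    by (rule integral_cong) (simp add: integrand)
  also have "\<dots> = (LBINT u:S. k u)"
    using set_borel_integral_eq_integral(2)[OF k_int] by simp
  finally have *: "(\<lambda>y. y powr s * q y) absolutely_integrable_on {0<..} \<and>
     integral {0<..} (\<lambda>y. y powr s * q y) = (LBINT u:S. k u)"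
    using has_absolute_integral_change_of_variables_1'[OF S der inj, of "\<lambda>y. y powr s * q y" "LBINT u:S. k u"] k_cong
    unfolding image by blast
  then show I: "set_integrable lborel {0<..} (\<lambda>y. y powr s * q y)"
    unfolding set_integrable_def by (subst (asm) integrable_completion) auto
  show "(LBINT y:{0<..}. y powr s * q y) = - (Gamma s * Gamma (1 - s / \<alpha>) / Gamma (2 + s - s / \<alpha>))"
    using * k_val beta_sum set_borel_integral_eq_integral(2)[OF I] by simp
qed

section \<open>The Stieltjes kernel\<close>

lemma Gamma_reflection_real: 
  fixes x :: real shows "Gamma x * Gamma (1 - x) = pi / sin (pi * x)"
proof -
  have "complex_of_real (Gamma x * Gamma (1 - x)) = complex_of_real (pi / sin (pi * x))"
    using Gamma_reflection_complex[of "of_real x"]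
    by (simp add: Gamma_complex_of_real[symmetric] flip: sin_of_real)
  then show ?thesis by (simp only: of_real_eq_iff)
qed

lemma mellin_inverse_shift:
  fixes s :: real
  assumes s: "-1 < s" "s < 0"
  shows "set_integrable lborel {0<..} (\<lambda>y. y powr s * (1 / (y + 1)))"
    and "(LBINT y:{0<..}. y powr s * (1 / (y + 1))) = - (pi / sin (pi * s))"
proof -
  have q: "1 / (ray_param 1 u + 1) = u powr (1 / 1)" if "0 < u" "u < 1" for u
    using that by (simp add: ray_param_def powr_minus field_simps)
  have surj: "\<exists>u>0. u < 1 \<and> ray_param 1 u = y" if "0 < y" for y
    using that by (intro exI[of _ "1 / (1 + y)"]) (auto simp: ray_param_def powr_minus powr_divide field_simps)
  note J = mellin_ray_param[of 1 s "\<lambda>y. 1 / (y + 1)", OF _ s _ q surj]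
  show "set_integrable lborel {0<..} (\<lambda>y. y powr s * (1 / (y + 1)))"
    by (rule J(1)) auto
  show "(LBINT y:{0<..}. y powr s * (1 / (y + 1))) = - (pi / sin (pi * s))"
    using J(2) Gamma_fact[of 1, where ?'a = real] by (simp add: Gamma_reflection_real)
qed

text \<open>
  Dividing by \<open>1 + y\<close> moves \<open>y + z\<close> into the segment from \<open>1\<close> to \<open>z\<close>, which is compact and avoids \<open>0\<close>
  because \<open>z\<close> is off the negative axis. The bound is uniform for \<open>w\<close> near \<open>z\<close>, so that it can dominate the difference
  quotients in the variable \<open>z\<close>.
\<close>

lemma norm_shift_lower_bound:
  fixes z :: complex
  assumes z: "z \<notin> \<real>\<^sub>\<le>\<^sub>0"
  obtains c where "c > 0" "\<And>w y. norm (w - z) < c \<Longrightarrow> y \<ge> 0 \<Longrightarrow> c * (1 + y) \<le> norm (of_real y + w)"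
proof -
  have "0 \<notin> closed_segment 1 z"
  proof
    assume "0 \<in> closed_segment 1 z"
    then obtain u where u: "0 \<le> u" "u \<le> 1" "0 = (1 - u) *\<^sub>R 1 + u *\<^sub>R z"
      by (auto simp: in_segment)
    then have "u \<noteq> 0" by auto
    with u have "z = of_real (- ((1 - u) / u))"
      by (auto simp: scaleR_conv_of_real field_simps add_eq_0_iff)
    also have "\<dots> \<in> \<real>\<^sub>\<le>\<^sub>0"
      using u by (subst nonpos_Reals_of_real_iff) auto
    finally have "z \<in> \<real>\<^sub>\<le>\<^sub>0" .
    with z show False ..
  qed
  then obtain d where d: "d > 0" "\<And>p. p \<in> closed_segment 1 z \<Longrightarrow> d \<le> norm p"
    using separate_point_closed[of "closed_segment 1 z" 0] by (auto simp: dist_norm)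
  show ?thesis
  proof (rule that[of "d / 2"])
    fix w :: complex and y :: real
    assume w: "norm (w - z) < d / 2" and y: "y \<ge> 0"
    have "(of_real y + z) / of_real (1 + y) = (1 - 1 / (1 + y)) *\<^sub>R 1 + (1 / (1 + y)) *\<^sub>R z"
    proof -
      have "1 - 1 / (1 + y) = y / (1 + y)" using y by (simp add: field_simps)
      then show ?thesis by (simp add: scaleR_conv_of_real add_divide_distrib)
    qed
    then have "(of_real y + z) / of_real (1 + y) \<in> closed_segment 1 z"
      using y by (auto simp: in_segment intro!: exI[of _ "1 / (1 + y)"])
    from d(2)[OF this] have "d \<le> norm (of_real y + z) / (1 + y)"
      unfolding norm_divide norm_of_real using y by simp
    then have "d * (1 + y) \<le> norm (of_real y + z)"
      using y by (simp add: pos_le_divide_eq)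
    moreover have "norm (of_real y + z) \<le> norm (of_real y + w) + norm (w - z)"
      using norm_triangle_ineq[of "of_real y + w" "z - w"] by (simp add: norm_minus_commute)
    moreover have "d / 2 \<le> d / 2 * (1 + y)" using d(1) y by simp
    ultimately show "d / 2 * (1 + y) \<le> norm (of_real y + w)"
      using w by linarith
  qed (use d in auto)
qed

lemma stieltjes_kernel_integrable:
  fixes s :: real and z :: complex
  assumes s: "-1 < s" "s < 0" and z: "z \<notin> \<real>\<^sub>\<le>\<^sub>0"
  shows "set_integrable lborel {0<..} (\<lambda>y. of_real (y powr s) / (of_real y + z))"
proof -
  obtain c where c: "c > 0" "\<And>w y. norm (w - z) < c \<Longrightarrow> y \<ge> 0 \<Longrightarrow> c * (1 + y) \<le> norm (of_real y + w)"
    using norm_shift_lower_bound[OF z] by metis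
  have b: "norm (complex_of_real (y powr s) / (of_real y + z)) \<le> y powr s * (1 / (y + 1)) / c" if "y > 0" for y
  proof -
    have *: "c * (1 + y) \<le> norm (of_real y + z)" "0 < c * (1 + y)"
      using c(1) c(2)[of z y] that by auto
    then have "y powr s / norm (of_real y + z) \<le> y powr s / (c * (1 + y))"
      by (intro divide_left_mono mult_pos_pos[of _ "c * (1 + y)"]) (auto intro: less_le_trans simp del: zero_less_norm_iff)
    then show ?thesis by (simp add: norm_divide mult.commute add.commute)
  qed
  have "set_integrable lborel {0<..} (\<lambda>y. y powr s * (1 / (y + 1)) / c)"
    using mellin_inverse_shift(1)[OF s] by (rule set_integrable_divide)
  then show ?thesis
    by (rule set_integrable_bound)
      (use c(1) in \<open>auto simp: set_borel_measurable_def abs_mult abs_divide intro!: AE_I2 order_trans[OF b]\<close>)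
qed

text \<open>
  The difference quotients are explicit, since
  \<open>1 / (y + w) - 1 / (y + z) = - (w - z) / ((y + w) (y + z))\<close>; dominated convergence applies to them directly.
\<close>

lemma stieltjes_kernel_deriv:
  fixes s :: real and z :: complex
  assumes s: "-1 < s" "s < 0" and z: "z \<notin> \<real>\<^sub>\<le>\<^sub>0"
  shows "((\<lambda>z. LBINT y:{0<..}. of_real (y powr s) / (of_real y + z)) has_field_derivative
           - (LBINT y:{0<..}. of_real (y powr s) / (of_real y + z)\<^sup>2)) (at z)"
proof -
  define I where "I w = (LBINT y:{0<..}. complex_of_real (y powr s) / (of_real y + w))" for w :: complex
  obtain c where c: "c > 0" "\<And>w y. norm (w - z) < c \<Longrightarrow> y \<ge> 0 \<Longrightarrow> c * (1 + y) \<le> norm (of_real y + w)"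
    using norm_shift_lower_bound[OF z] by metis
  have nz: "of_real y + w \<noteq> 0" if "norm (w - z) < c" "y > 0" for w :: complex and y
    using c(1) c(2)[OF that(1), of y] that by (auto simp: mult_le_0_iff)
  have "((\<lambda>w. (I w - I z) / (w - z)) \<longlongrightarrow> - (LBINT y:{0<..}. of_real (y powr s) / (of_real y + z)\<^sup>2)) (at z)"
    unfolding tendsto_at_iff_sequentially
  proof (intro allI impI)
    fix X :: "nat \<Rightarrow> complex"
    assume X: "\<forall>i. X i \<in> UNIV - {z}" "X \<longlonglongrightarrow> z"
    define h where "h w y = indicator {0<..} y *\<^sub>R (- (complex_of_real (y powr s) / ((of_real y + w) * (of_real y + z))))" for w y
    have ev: "eventually (\<lambda>n. norm (X n - z) < c) sequentially"
      using X(2) c(1) by (simp add: tendsto_iff dist_norm)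
    have eq: "(I w - I z) / (w - z) = (LINT y|lborel. h w y)" if "norm (w - z) < c" "w \<noteq> z" for w
    proof -
      have w: "w \<notin> \<real>\<^sub>\<le>\<^sub>0"
      proof
        assume "w \<in> \<real>\<^sub>\<le>\<^sub>0"
        then obtain r where "w = of_real r" "r \<le> 0"
          by (rule nonpos_Reals_cases) auto
        then show False using c(1) c(2)[OF that(1), of "- r"] by (auto simp: mult_le_0_iff)
      qed
      have "I w - I z = (LBINT y:{0<..}. complex_of_real (y powr s) / (of_real y + w) - of_real (y powr s) / (of_real y + z))"
        unfolding I_def using stieltjes_kernel_integrable[OF s w] stieltjes_kernel_integrable[OF s z]
        by (rule set_integral_diff(2)[symmetric])
      also have "\<dots> = (LINT y|lborel. h w y * (w - z))"
        unfolding set_lebesgue_integral_def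
      proof (intro Bochner_Integration.integral_cong refl)
        fix y :: real
        show "indicat_real {0<..} y *\<^sub>R (complex_of_real (y powr s) / (of_real y + w) - of_real (y powr s) / (of_real y + z)) = h w y * (w - z)"
        proof (cases "y > 0")
          case True
          have *: "v / a - v / b = - (v / (a * b)) * (a - b)" if "a \<noteq> 0" "b \<noteq> 0" for v a b :: complex
            using that by (simp add: field_simps)
          show ?thesis
            using *[of "of_real y + w" "of_real y + z" "of_real (y powr s)"] nz[OF \<open>norm (w - z) < c\<close> True] nz[of z y] c(1) True
            by (simp add: h_def)
        qed (simp add: h_def)
      qed
      finally show ?thesis using that by simp
    qed
    have "(\<lambda>n. LINT y|lborel. h (X n) y) \<longlonglongrightarrow> (LINT y|lborel. h z y)"
    proof -
      obtain N where N: "\<And>n. n \<ge> N \<Longrightarrow> norm (X n - z) < c"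
        using ev by (auto simp: eventually_sequentially)
      have "(\<lambda>n. LINT y|lborel. h (X (n + N)) y) \<longlonglongrightarrow> (LINT y|lborel. h z y)"
      proof (rule integral_dominated_convergence)
        show "integrable lborel (\<lambda>y. indicator {0<..} y *\<^sub>R (y powr s * (1 / (y + 1)) / c\<^sup>2))"
          using set_integrable_divide[OF mellin_inverse_shift(1)[OF s]] unfolding set_integrable_def .
        show "AE y in lborel. (\<lambda>n. h (X (n + N)) y) \<longlonglongrightarrow> h z y"
        proof (intro AE_I2)
          fix y :: real
          show "(\<lambda>n. h (X (n + N)) y) \<longlonglongrightarrow> h z y"
          proof (cases "y > 0")
            case True
            then show ?thesis
              unfolding h_def using nz[of z y] c(1) LIMSEQ_ignore_initial_segment[OF X(2), of N]
              by (intro tendsto_scaleR tendsto_const tendsto_minus tendsto_divide tendsto_mult tendsto_add) auto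
          qed (simp add: h_def)
        qed
        show "AE y in lborel. norm (h (X (n + N)) y) \<le> indicator {0<..} y *\<^sub>R (y powr s * (1 / (y + 1)) / c\<^sup>2)" for n
        proof (intro AE_I2)
          fix y :: real
          show "norm (h (X (n + N)) y) \<le> indicator {0<..} y *\<^sub>R (y powr s * (1 / (y + 1)) / c\<^sup>2)"
          proof (cases "y > 0")
            case True
            have "c * (1 + y) * c \<le> norm (of_real y + X (n + N)) * norm (of_real y + z)"
            proof (rule mult_mono)
              show "c * (1 + y) \<le> norm (of_real y + X (n + N))" using c(2) N True by simp
              have "c \<le> c * (1 + y)" using c(1) True by simp
              also have "\<dots> \<le> norm (of_real y + z)" using c(2)[of z y] c(1) True by simp
              finally show "c \<le> norm (of_real y + z)" .
            qed (use c(1) in auto)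
            then have "y powr s / (norm (of_real y + X (n + N)) * norm (of_real y + z)) \<le> y powr s / (c * (1 + y) * c)"
              using c(1) True nz[of z y] nz[of "X (n + N)" y] N[of "n + N"] by (intro divide_left_mono mult_pos_pos) auto
            moreover have "norm (h (X (n + N)) y) = y powr s / (norm (of_real y + X (n + N)) * norm (of_real y + z))"
              using True by (simp add: h_def norm_divide norm_mult)
            moreover have "y powr s / (c * (1 + y) * c) = y powr s * (1 / (y + 1)) / c\<^sup>2"
              by (simp add: power2_eq_square mult_ac add.commute)
            ultimately show ?thesis
              using True by simp
          qed (simp add: h_def)
        qed
      qed (auto simp: h_def)
      then show ?thesis by (rule LIMSEQ_offset)
    qed
    then have "(\<lambda>n. (I (X n) - I z) / (X n - z)) \<longlonglongrightarrow> (LINT y|lborel. h z y)"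
      by (rule Lim_transform_eventually) (use ev X(1) eq in \<open>auto elim!: eventually_mono\<close>)
    also have "(LINT y|lborel. h z y) = - (LBINT y:{0<..}. of_real (y powr s) / (of_real y + z)\<^sup>2)"
      by (simp add: h_def set_lebesgue_integral_def power2_eq_square)
    finally show "((\<lambda>w. (I w - I z) / (w - z)) \<circ> X) \<longlonglongrightarrow> - (LBINT y:{0<..}. of_real (y powr s) / (of_real y + z)\<^sup>2)"
      by (simp add: o_def)
  qed
  then show ?thesis
    by (simp add: has_field_derivative_iff I_def[abs_def])
qed

lemma stieltjes_kernel_real:
  fixes s a :: real
  assumes s: "-1 < s" "s < 0" and a: "a > 0"
  shows "set_integrable lborel {0<..} (\<lambda>y. y powr s / (y + a))"
    and "(LBINT y:{0<..}. y powr s / (y + a)) = - (pi / sin (pi * s)) * a powr s"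
proof -
  let ?f = "\<lambda>y. indicator {0<..} y *\<^sub>R (y powr s / (y + a))"
  have scale: "?f (0 + a * x) = (a powr s / a) * (indicator {0<..} x *\<^sub>R (x powr s * (1 / (x + 1))))" for x
  proof (cases "x > 0")
    case True
    have "a * x + a = a * (x + 1)" by (simp add: algebra_simps)
    with True a show ?thesis by (simp add: powr_mult)
  qed (use a in \<open>simp add: zero_less_mult_iff\<close>)
  have "integrable lborel (\<lambda>x. ?f (0 + a * x))"
    unfolding scale using mellin_inverse_shift(1)[OF s] unfolding set_integrable_def by (rule integrable_mult_right)
  then show "set_integrable lborel {0<..} (\<lambda>y. y powr s / (y + a))"
    unfolding set_integrable_def using a by (subst (asm) lborel_integrable_real_affine_iff) auto
  have "(LBINT y:{0<..}. y powr s / (y + a)) = \<bar>a\<bar> *\<^sub>R (LINT x|lborel. ?f (0 + a * x))"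
    unfolding set_lebesgue_integral_def using a by (intro lborel_integral_real_affine) auto
  also have "\<dots> = a powr s * (LBINT y:{0<..}. y powr s * (1 / (y + 1)))"
    unfolding scale set_lebesgue_integral_def by (subst integral_mult_right_zero) (use a in simp)
  finally show "(LBINT y:{0<..}. y powr s / (y + a)) = - (pi / sin (pi * s)) * a powr s"
    using mellin_inverse_shift(2)[OF s] by simp
qed

text \<open>
  For real \<open>z > 0\<close> the identity is a rescaling of the case \<open>z = 1\<close>. Both sides are holomorphic in the slit plane,
  so the identity theorem extends it; this stands in for a rotation of the path of integration.
\<close>

lemma stieltjes_kernel:
  fixes s :: real and z :: complex
  assumes s: "-1 < s" "s < 0" and z: "z \<notin> \<real>\<^sub>\<le>\<^sub>0"
  shows "(LBINT y:{0<..}. complex_of_real (y powr s) / (of_real y + z))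
    = of_real (- (pi / sin (pi * s))) * z powr (of_real s)"
proof -
  define D where "D z = (LBINT y:{0<..}. complex_of_real (y powr s) / (of_real y + z))
      - of_real (- (pi / sin (pi * s))) * z powr (of_real s)" for z :: complex
  have "D z = 0"
  proof (rule analytic_continuation[of D "- \<real>\<^sub>\<le>\<^sub>0" "of_real ` {0<..}" 1])
    have "(\<lambda>z. LBINT y:{0<..}. complex_of_real (y powr s) / (of_real y + z)) holomorphic_on - \<real>\<^sub>\<le>\<^sub>0"
      using stieltjes_kernel_deriv[OF s]
      by (subst holomorphic_on_open) (auto simp: closed_nonpos_Reals_complex open_Compl)
    then show "D holomorphic_on - \<real>\<^sub>\<le>\<^sub>0"
      unfolding D_def[abs_def] by (intro holomorphic_intros) auto
    show "connected (- \<real>\<^sub>\<le>\<^sub>0 :: complex set)"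
    proof -
      have "\<real>\<^sub>\<le>\<^sub>0 = complex_of_real ` {..0}" by (auto simp: nonpos_Reals_def)
      then show ?thesis using starlike_imp_connected[OF starlike_slotted_complex_plane_left[of 0]] by simp
    qed
    show "1 islimpt complex_of_real ` {0<..}"
      unfolding islimpt_approachable
    proof (intro allI impI)
      fix e :: real assume "e > 0"
      then show "\<exists>x'\<in>complex_of_real ` {0<..}. x' \<noteq> 1 \<and> dist x' 1 < e"
        by (intro bexI[of _ "of_real (1 + e / 2)"] imageI) (auto simp: dist_norm)
    qed
    fix w assume "w \<in> complex_of_real ` {0<..}"
    then obtain a where a: "w = of_real a" "a > 0" by auto
    have "(LBINT y:{0<..}. complex_of_real (y powr s) / (of_real y + of_real a))
      = (LINT y|lborel. complex_of_real (indicator {0<..} y *\<^sub>R (y powr s / (y + a))))"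
      unfolding set_lebesgue_integral_def
      by (intro Bochner_Integration.integral_cong refl) (auto simp: indicator_def)
    also have "\<dots> = of_real (- (pi / sin (pi * s)) * a powr s)"
      unfolding integral_complex_of_real using stieltjes_kernel_real(2)[OF s a(2)]
      by (simp only: set_lebesgue_integral_def)
    finally show "D w = 0"
      unfolding D_def a using a(2) by (simp add: powr_of_real)
  qed (use z in \<open>auto simp: closed_nonpos_Reals_complex open_Compl complex_nonpos_Reals_iff\<close>)
  then show ?thesis unfolding D_def by (simp only: right_minus_eq)
qed

section \<open>Extending a Laplace transform past its known range\<close>

lemma powser_eq_zero_if_real_zeros:
  fixes a :: "nat \<Rightarrow> complex" and \<epsilon> :: real
  assumes \<epsilon>: "\<epsilon> > 0"
    and summable: "\<And>z. norm z < \<epsilon> \<Longrightarrow> summable (\<lambda>n. a n * z ^ n)"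
    and zero: "\<And>h. 0 < h \<Longrightarrow> h < \<epsilon> \<Longrightarrow> (\<Sum>n. a n * of_real h ^ n) = 0"
  shows "a m = 0"
proof -
  define F where "F z = (\<Sum>n. a n * z ^ n)" for z
  have sums: "(\<lambda>n. a n * (z - 0) ^ n) sums F z" if "norm (z - 0) < \<epsilon>" for z
    unfolding F_def using summable[of z] that by (simp add: summable_sums)
  have "F 0 = 0"
  proof (rule analytic_continuation[of F "ball 0 \<epsilon>" "of_real ` {0<..<\<epsilon>}" 0])
    show "F holomorphic_on ball 0 \<epsilon>"
      by (rule power_series_holomorphic[where a = a]) (use sums in \<open>auto simp: dist_norm\<close>)
    show "0 islimpt complex_of_real ` {0<..<\<epsilon>}"
      unfolding islimpt_approachable
    proof (intro allI impI)
      fix e :: real assume "e > 0"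
      with \<epsilon> show "\<exists>x'\<in>complex_of_real ` {0<..<\<epsilon>}. x' \<noteq> 0 \<and> dist x' 0 < e"
        by (intro bexI[of _ "of_real (min e \<epsilon> / 2)"] imageI) (auto simp: dist_norm)
    qed
  qed (use \<epsilon> zero in \<open>auto simp: F_def\<close>)
  moreover have "F 0 = a 0" unfolding F_def by (rule powser_zero)
  ultimately have a0: "a 0 = 0" by simp
  show ?thesis
  proof (cases "m = 0")
    case False
    show ?thesis
    proof (rule ccontr)
      assume "a m \<noteq> 0"
      then obtain s where s: "s > 0" "\<And>z. z \<in> cball 0 s - {0} \<Longrightarrow> F z \<noteq> 0"
        using powser_0_nonzero[of \<epsilon> 0 a F m] \<epsilon> sums \<open>F 0 = 0\<close> False by auto
      define h where "h = min s \<epsilon> / 2"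
      have "h > 0" "h < \<epsilon>" "h \<le> s" using s(1) \<epsilon> by (auto simp: h_def)
      then show False
        using s(2)[of "of_real h"] zero[of h] by (auto simp: F_def)
    qed
  qed (use a0 in simp)
qed

text \<open>
  Only even powers occur in the expansion of the hyperbolic cosine. All terms are therefore nonnegative, whatever the
  sign of \<open>\<phi>\<close>, and the sum can be exchanged with the integral without knowing that anything is finite.
\<close>

lemma nn_integral_exp_cosh:
  fixes w \<phi> :: "'a \<Rightarrow> real" and s h :: real
  assumes [measurable]: "w \<in> borel_measurable M" "\<phi> \<in> borel_measurable M" and w: "\<And>x. w x \<ge> 0"
  shows "(\<integral>\<^sup>+x. ennreal (w x * exp (s * \<phi> x) * cosh (h * \<phi> x)) \<partial>M)
     = (\<Sum>n. ennreal (h ^ (2 * n)) * (\<integral>\<^sup>+x. ennreal (w x * exp (s * \<phi> x) * (\<phi> x ^ (2 * n) / fact (2 * n))) \<partial>M))"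
proof -
  have cosh: "(\<lambda>n. x ^ (2 * n) / fact (2 * n)) sums cosh x" for x :: real
  proof -
    define c where "c n = (if even n then x ^ n /\<^sub>R fact n else 0)" for n
    have "c sums cosh x" unfolding c_def by (rule cosh_converges)
    moreover have "c n = 0" if "n \<notin> range ((*) 2)" for n
      using that by (auto simp: c_def elim!: evenE)
    ultimately have "(\<lambda>n. c (2 * n)) sums cosh x"
      by (subst sums_mono_reindex) (auto simp: strict_mono_def)
    then show ?thesis by (simp add: c_def divide_inverse mult.commute)
  qed
  have term_eq: "ennreal (w x * exp (s * \<phi> x) * cosh (h * \<phi> x))
      = (\<Sum>n. ennreal (h ^ (2 * n)) * ennreal (w x * exp (s * \<phi> x) * (\<phi> x ^ (2 * n) / fact (2 * n))))" for x
  proof -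
    have "(\<lambda>n. (w x * exp (s * \<phi> x)) * ((h * \<phi> x) ^ (2 * n) / fact (2 * n))) sums (w x * exp (s * \<phi> x) * cosh (h * \<phi> x))"
      by (intro sums_mult cosh)
    moreover have "0 \<le> (w x * exp (s * \<phi> x)) * ((h * \<phi> x) ^ (2 * n) / fact (2 * n))" for n
      using w by (intro mult_nonneg_nonneg divide_nonneg_nonneg zero_le_even_power) auto
    ultimately have "(\<Sum>n. ennreal ((w x * exp (s * \<phi> x)) * ((h * \<phi> x) ^ (2 * n) / fact (2 * n)))) = ennreal (w x * exp (s * \<phi> x) * cosh (h * \<phi> x))"
      by (subst suminf_ennreal2) (auto simp: sums_iff)
    then show ?thesis
      using w by (simp add: ennreal_mult'[symmetric] power_mult_distrib mult_ac zero_le_even_power)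
  qed
  show ?thesis
    unfolding term_eq by (subst nn_integral_suminf) (auto simp: nn_integral_cmult)
qed

text \<open>
  The even part of \<open>f\<close> about \<open>\<sigma>\<close> and the integral of \<open>w exp (\<sigma> \<phi>) cosh (t \<phi>)\<close> agree for small \<open>t\<close>,
  and both are power series in \<open>t\<close>, so their coefficients agree. The series of \<open>f\<close> converges on the whole disc; hence the
  integral is finite for every \<open>t < r\<close> and equals the even part of \<open>f\<close>. Since the transform is known to the left of
  \<open>\<sigma>\<close>, subtracting its value at \<open>\<sigma> - h\<close> gives the one at \<open>\<sigma> + h\<close>. Using the cosine
  instead of the exponential avoids a separate treatment of the part where \<open>\<phi>\<close> is negative.
\<close>

lemma laplace_transform_extension_step:
  fixes M :: "'a measure" and w \<phi> :: "'a \<Rightarrow> real" and g :: "real \<Rightarrow> real" and f :: "complex \<Rightarrow> complex"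
  assumes [measurable]: "w \<in> borel_measurable M" "\<phi> \<in> borel_measurable M" and w: "\<And>x. w x \<ge> 0"
    and f: "f holomorphic_on ball (of_real \<sigma>) r"
    and fg: "\<And>s. \<bar>s - \<sigma>\<bar> < r \<Longrightarrow> f (of_real s) = of_real (g s)"
    and \<epsilon>: "0 < \<epsilon>" "\<epsilon> \<le> r"
    and known: "\<And>s. \<sigma> - r < s \<Longrightarrow> s < \<sigma> + \<epsilon> \<Longrightarrow> has_bochner_integral M (\<lambda>x. w x * exp (s * \<phi> x)) (g s)"
    and h: "0 < h" "h < r"
  shows "has_bochner_integral M (\<lambda>x. w x * exp ((\<sigma> + h) * \<phi> x)) (g (\<sigma> + h))"
proof -
  \<comment> \<open>the even part of \<open>f\<close> about \<open>\<sigma>\<close>\<close>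
  define k where "k z = (f (of_real \<sigma> + z) + f (of_real \<sigma> - z)) / 2" for z
  define c where "c n = (deriv ^^ n) k 0 / fact n" for n
  define m where "m n = (\<integral>\<^sup>+x. ennreal (w x * exp (\<sigma> * \<phi> x) * (\<phi> x ^ (2 * n) / fact (2 * n))) \<partial>M)" for n
  define C where "C t x = w x * exp (\<sigma> * \<phi> x) * cosh (t * \<phi> x)" for t x
  have C_eq: "C t x = (w x * exp ((\<sigma> + t) * \<phi> x) + w x * exp ((\<sigma> - t) * \<phi> x)) / 2" for t x
  proof -
    have "exp ((\<sigma> + t) * \<phi> x) = exp (\<sigma> * \<phi> x) * exp (t * \<phi> x)"
      "exp ((\<sigma> - t) * \<phi> x) = exp (\<sigma> * \<phi> x) * exp (- (t * \<phi> x))"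
      by (simp_all add: algebra_simps flip: exp_add)
    then show ?thesis by (simp only: C_def cosh_field_def) (simp add: distrib_left)
  qed
  have C_nonneg: "C t x \<ge> 0" for t x using w by (simp add: C_def)
  have [measurable]: "C t \<in> borel_measurable M" for t unfolding C_def cosh_field_def by measurable
  have nnC: "(\<integral>\<^sup>+x. ennreal (C t x) \<partial>M) = (\<Sum>n. ennreal (t ^ (2 * n)) * m n)" for t
    unfolding C_def m_def by (rule nn_integral_exp_cosh) (use w in auto)
  have k_holo: "k holomorphic_on ball 0 r"
  proof -
    have "(f \<circ> (\<lambda>z. of_real \<sigma> + z)) holomorphic_on ball 0 r" "(f \<circ> (\<lambda>z. of_real \<sigma> - z)) holomorphic_on ball 0 r"
      by (rule holomorphic_on_compose_gen[OF _ f]; auto intro!: holomorphic_intros simp: dist_norm)+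
    then show ?thesis
      unfolding k_def[abs_def] by (auto intro!: holomorphic_intros simp: o_def)
  qed
  have k_sums: "(\<lambda>n. c n * z ^ n) sums k z" if "norm z < r" for z
    using holomorphic_power_series[OF k_holo, of z] that by (simp add: c_def)
  have k_real: "k (of_real t) = of_real ((g (\<sigma> + t) + g (\<sigma> - t)) / 2)" if "\<bar>t\<bar> < r" for t
    using fg[of "\<sigma> + t"] fg[of "\<sigma> - t"] that by (simp add: k_def)
  have small: "(\<integral>\<^sup>+x. ennreal (C t x) \<partial>M) = ennreal ((g (\<sigma> + t) + g (\<sigma> - t)) / 2)"
    and small_nonneg: "0 \<le> (g (\<sigma> + t) + g (\<sigma> - t)) / 2" if "0 < t" "t < \<epsilon>" for t
  proof -
    have "has_bochner_integral M (C t) ((g (\<sigma> + t) + g (\<sigma> - t)) / 2)"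
      unfolding C_eq using that \<epsilon> by (intro has_bochner_integral_divide_zero has_bochner_integral_add known) auto
    then have I: "integrable M (C t)" "integral\<^sup>L M (C t) = (g (\<sigma> + t) + g (\<sigma> - t)) / 2"
      unfolding has_bochner_integral_iff by blast+
    show "(\<integral>\<^sup>+x. ennreal (C t x) \<partial>M) = ennreal ((g (\<sigma> + t) + g (\<sigma> - t)) / 2)"
      unfolding I(2)[symmetric] by (rule nn_integral_eq_integral[OF I(1)]) (simp add: C_nonneg)
    show "0 \<le> (g (\<sigma> + t) + g (\<sigma> - t)) / 2"
      unfolding I(2)[symmetric] by (rule integral_nonneg_AE) (simp add: C_nonneg)
  qed
  have m_fin: "m n < \<infinity>" for n
  proof -
    define t where "t = \<epsilon> / 2"
    have t: "0 < t" "t < \<epsilon>" using \<epsilon> by (auto simp: t_def)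
    have "ennreal (t ^ (2 * n)) * m n \<le> (\<Sum>n. ennreal (t ^ (2 * n)) * m n)"
      using sum_le_suminf[of "\<lambda>n. ennreal (t ^ (2 * n)) * m n" "{n}"] by simp
    also have "\<dots> < \<infinity>" unfolding nnC[symmetric] small[OF t] by simp
    finally show ?thesis using t by (auto simp: ennreal_mult_less_top)
  qed
  define e where "e n = enn2real (m n)" for n
  have m_e: "m n = ennreal (e n)" and e_nonneg: "e n \<ge> 0" for n
    using m_fin[of n] by (auto simp: e_def less_top)
  have nnC': "(\<integral>\<^sup>+x. ennreal (C t x) \<partial>M) = (\<Sum>n. ennreal (e n * t ^ (2 * n)))" for t
    unfolding nnC m_e using e_nonneg by (simp add: ennreal_mult' [symmetric] zero_le_even_power mult.commute)
  have e_sums: "(\<lambda>n. e n * t ^ (2 * n)) sums ((g (\<sigma> + t) + g (\<sigma> - t)) / 2)" if t: "0 < t" "t < \<epsilon>" for t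
  proof -
    have *: "(\<Sum>n. ennreal (e n * t ^ (2 * n))) = ennreal ((g (\<sigma> + t) + g (\<sigma> - t)) / 2)"
      unfolding nnC'[symmetric] by (rule small[OF t])
    have nn: "0 \<le> e n * t ^ (2 * n)" for n using e_nonneg t by simp
    have sm: "summable (\<lambda>n. e n * t ^ (2 * n))"
      by (rule summable_suminf_not_top) (use nn * in auto)
    have "ennreal (\<Sum>n. e n * t ^ (2 * n)) = ennreal ((g (\<sigma> + t) + g (\<sigma> - t)) / 2)"
      using * suminf_ennreal2[OF nn sm] by simp
    then have "(\<Sum>n. e n * t ^ (2 * n)) = (g (\<sigma> + t) + g (\<sigma> - t)) / 2"
      using small_nonneg[OF t] suminf_nonneg[OF sm nn] by simp
    then show ?thesis using sm by (simp add: sums_iff)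
  qed
  \<comment> \<open>\<open>e\<close> spread over the even indices, to be compared with the Taylor coefficients \<open>c\<close>\<close>
  define d where "d n = (if even n then e (n div 2) else 0)" for n
  have reindex: "(\<lambda>n. e n * t ^ (2 * n)) sums v \<longleftrightarrow> (\<lambda>n. d n * t ^ n) sums v" for t v :: real
  proof -
    have "d n * t ^ n = 0" if "n \<notin> range ((*) 2)" for n
      using that by (auto simp: d_def elim!: evenE)
    then have "(\<lambda>n. d (2 * n) * t ^ (2 * n)) sums v \<longleftrightarrow> (\<lambda>n. d n * t ^ n) sums v"
      by (intro sums_mono_reindex) (auto simp: strict_mono_def)
    then show ?thesis by (simp add: d_def)
  qed
  have c_eq: "c n = of_real (d n)" for n
  proof -
    have d_summable: "summable (\<lambda>n. of_real (d n) * z ^ n)" if "norm z < \<epsilon>" for z :: complex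
    proof -
      obtain t where t: "norm z < t" "t < \<epsilon>" using \<open>norm z < \<epsilon>\<close> dense by blast
      then have "0 < t" using norm_ge_zero[of z] by linarith
      then have "(\<lambda>n. d n * t ^ n) sums ((g (\<sigma> + t) + g (\<sigma> - t)) / 2)"
        using e_sums[of t] t reindex by simp
      then have "summable (\<lambda>n. complex_of_real (d n) * of_real t ^ n)"
        using summable_of_real[of "\<lambda>n. d n * t ^ n"] by (simp add: sums_iff)
      then show ?thesis by (rule powser_inside) (use t \<open>0 < t\<close> in auto)
    qed
    have "c n - of_real (d n) = 0"
    proof (rule powser_eq_zero_if_real_zeros[where \<epsilon> = \<epsilon> and a = "\<lambda>n. c n - of_real (d n)"])
      show "summable (\<lambda>n. (c n - of_real (d n)) * z ^ n)" if "norm z < \<epsilon>" for z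
        using summable_diff[OF sums_summable[OF k_sums[of z]] d_summable[OF that]] that \<epsilon> by (simp add: left_diff_distrib)
      show "(\<Sum>n. (c n - of_real (d n)) * of_real t ^ n) = 0" if "0 < t" "t < \<epsilon>" for t
      proof -
        have "(\<lambda>n. complex_of_real (d n * t ^ n)) sums of_real ((g (\<sigma> + t) + g (\<sigma> - t)) / 2)"
          using e_sums[OF that] reindex sums_of_real by blast
        from sums_diff[OF k_sums[of "of_real t"] this] show ?thesis
          using that \<epsilon> k_real[of t] by (simp add: left_diff_distrib sums_iff)
      qed
    qed (use \<epsilon> in auto)
    then show ?thesis by simp
  qed
  have "(\<lambda>n. of_real (d n * h ^ n)) sums complex_of_real ((g (\<sigma> + h) + g (\<sigma> - h)) / 2)"
    using k_sums[of "of_real h"] k_real[of h] h by (simp add: c_eq)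
  then have "(\<lambda>n. d n * h ^ n) sums ((g (\<sigma> + h) + g (\<sigma> - h)) / 2)"
    by (rule sums_of_real_iff[THEN iffD1])
  then have e_sums_h: "(\<lambda>n. e n * h ^ (2 * n)) sums ((g (\<sigma> + h) + g (\<sigma> - h)) / 2)"
    using reindex by simp
  have nn: "0 \<le> e n * h ^ (2 * n)" for n using e_nonneg h by simp
  have nnC_h: "(\<integral>\<^sup>+x. ennreal (C h x) \<partial>M) = ennreal ((g (\<sigma> + h) + g (\<sigma> - h)) / 2)"
    unfolding nnC' suminf_ennreal2[OF nn sums_summable[OF e_sums_h]] sums_unique[OF e_sums_h] ..
  have "0 \<le> (g (\<sigma> + h) + g (\<sigma> - h)) / 2"
    using suminf_nonneg[OF sums_summable[OF e_sums_h] nn] e_sums_h by (simp add: sums_iff)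
  then have "has_bochner_integral M (C h) ((g (\<sigma> + h) + g (\<sigma> - h)) / 2)"
    by (intro has_bochner_integral_nn_integral nnC_h) (auto simp: C_nonneg)
  then have "has_bochner_integral M (\<lambda>x. C h x * 2 - w x * exp ((\<sigma> - h) * \<phi> x)) ((g (\<sigma> + h) + g (\<sigma> - h)) / 2 * 2 - g (\<sigma> - h))"
    using h \<epsilon> by (intro has_bochner_integral_diff has_bochner_integral_mult_left known) auto
  moreover have "C h x * 2 - w x * exp ((\<sigma> - h) * \<phi> x) = w x * exp ((\<sigma> + h) * \<phi> x)" for x
    by (simp add: C_eq field_simps)
  moreover have "(g (\<sigma> + h) + g (\<sigma> - h)) / 2 * 2 - g (\<sigma> - h) = g (\<sigma> + h)"
    by (simp add: field_simps)
  ultimately show ?thesis by (simp only:)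
qed

text \<open>
  A disc about a point \<open>\<sigma>\<close> just below the current bound \<open>t\<close> may have any radius up to the smaller of \<open>\<sigma> - a\<close>
  and \<open>b - \<sigma>\<close>, so one step moves the bound to the smaller of \<open>2 t - a\<close> and \<open>b\<close>: the length of the known interval doubles until it reaches \<open>b\<close>.
\<close>

lemma laplace_transform_extension:
  fixes M :: "'a measure" and w \<phi> :: "'a \<Rightarrow> real" and g :: "real \<Rightarrow> real" and f :: "complex \<Rightarrow> complex"
  assumes meas: "w \<in> borel_measurable M" "\<phi> \<in> borel_measurable M" and w: "\<And>x. w x \<ge> 0"
    and f: "f holomorphic_on {z. a < Re z \<and> Re z < b}"
    and fg: "\<And>s. a < s \<Longrightarrow> s < b \<Longrightarrow> f (of_real s) = of_real (g s)"
    and c: "a < c" "c \<le> b"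
    and known: "\<And>s. a < s \<Longrightarrow> s < c \<Longrightarrow> has_bochner_integral M (\<lambda>x. w x * exp (s * \<phi> x)) (g s)"
    and s: "a < s" "s < b"
  shows "has_bochner_integral M (\<lambda>x. w x * exp (s * \<phi> x)) (g s)"
proof -
  define K where "K t \<longleftrightarrow> (\<forall>s. a < s \<and> s < t \<longrightarrow> has_bochner_integral M (\<lambda>x. w x * exp (s * \<phi> x)) (g s))" for t
  have step: "K (min b (2 * t - a))" if t: "a < t" "t \<le> b" "K t" for t
    unfolding K_def
  proof (intro allI impI, elim conjE)
    fix s assume s: "a < s" "s < min b (2 * t - a)"
    show "has_bochner_integral M (\<lambda>x. w x * exp (s * \<phi> x)) (g s)"
    proof (cases "s < t")
      case False
      \<comment> \<open>any centre between \<open>(s + a) / 2\<close> and \<open>t\<close> has \<open>s\<close> within distance \<open>\<sigma> - a\<close>\<close>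
      define \<sigma> where "\<sigma> = ((s + a) / 2 + t) / 2"
      have \<sigma>: "(s + a) / 2 < \<sigma>" "\<sigma> < t" using s by (auto simp: \<sigma>_def field_simps)
      define r where "r = min (\<sigma> - a) (b - \<sigma>)"
      have ball: "ball (of_real \<sigma>) r \<subseteq> {z. a < Re z \<and> Re z < b}"
      proof
        fix z assume "z \<in> ball (complex_of_real \<sigma>) r"
        then have "\<bar>Re (z - of_real \<sigma>)\<bar> < r"
          using abs_Re_le_cmod[of "z - of_real \<sigma>"] by (simp add: dist_norm norm_minus_commute)
        then show "z \<in> {z. a < Re z \<and> Re z < b}" by (auto simp: r_def)
      qed
      have "has_bochner_integral M (\<lambda>x. w x * exp ((\<sigma> + (s - \<sigma>)) * \<phi> x)) (g (\<sigma> + (s - \<sigma>)))"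
      proof (rule laplace_transform_extension_step[OF meas w, of f \<sigma> r g "min r (t - \<sigma>)"])
        show "f holomorphic_on ball (of_real \<sigma>) r" using f ball by (rule holomorphic_on_subset)
        show "f (of_real s) = of_real (g s)" if "\<bar>s - \<sigma>\<bar> < r" for s
          using that by (intro fg) (auto simp: r_def)
        show "has_bochner_integral M (\<lambda>x. w x * exp (s * \<phi> x)) (g s)" if "\<sigma> - r < s" "s < \<sigma> + min r (t - \<sigma>)" for s
        proof -
          have "a < s" "s < t" using that by (auto simp: r_def)
          then show ?thesis using t(3) by (simp add: K_def)
        qed
      qed (use \<sigma> s t False in \<open>auto simp: r_def\<close>)
      then show ?thesis by simp
    qed (use t(3) s in \<open>auto simp: K_def\<close>)
  qed
  have K: "K (min b (a + (c - a) * 2 ^ n))" for n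
  proof (induction n)
    case 0
    then show ?case using known c by (auto simp: K_def)
  next
    case (Suc n)
    have "a < a + (c - a) * 2 ^ n" using c by simp
    then have "K (min b (2 * min b (a + (c - a) * 2 ^ n) - a))"
      using c by (intro step Suc.IH) auto
    moreover have "min b (2 * min b (a + (c - a) * 2 ^ n) - a) = min b (a + (c - a) * 2 ^ Suc n)"
      using c by (auto simp: min_def algebra_simps)
    ultimately show ?case by simp
  qed
  obtain n where "(s - a) / (c - a) < 2 ^ n" using real_arch_pow[of 2] by auto
  then have "s < a + (c - a) * 2 ^ n" using c by (simp add: field_simps)
  then show ?thesis using K[of n] s by (auto simp: K_def)
qed

section \<open>From the Cauchy transform on a ray to moments\<close>

lemma powr_polar:
  assumes "r > 0" "- pi < \<theta>" "\<theta> \<le> pi"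
  shows "(of_real r * cis \<theta>) powr (of_real s) = of_real (r powr s) * cis (\<theta> * s)"
proof -
  have "of_real r * cis \<theta> = exp (of_real (ln r) + \<i> * of_real \<theta>)"
    using assms by (simp add: exp_add cis_conv_exp exp_of_real)
  then have "Ln (of_real r * cis \<theta>) = of_real (ln r) + \<i> * of_real \<theta>"
    using assms by (simp only:) (rule Ln_exp; simp)
  then show ?thesis
    using assms by (simp add: powr_def exp_add cis_conv_exp algebra_simps flip: exp_of_real of_real_mult)
qed

text \<open>
  The assumption \<open>low\<close> bounds the distance from \<open>x\<close> to the points of the ray in direction \<open>cis (\<pi>\<rho>)\<close>; it holds for every
  law if \<open>0 < \<rho> < 1\<close>, and for \<open>\<rho> = 1\<close> if the law has no mass on the negative half-line. The assumption \<open>ray_abs\<close> controls a nonnegative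
  kernel. Integrated against \<open>y powr s\<close>, that kernel dominates a multiple of \<open>\<bar>x\<bar> powr s\<close>, which makes the absolute
  moment finite; only then can the integrals be exchanged for the complex kernel.
\<close>

lemma mellin_from_ray:
  fixes \<nu> :: "real measure" and \<alpha> \<rho> s c :: real
  assumes "prob_space \<nu>" and sets_nu [measurable_cong]: "sets \<nu> = sets borel"
    and \<alpha>: "0 < \<alpha>" and \<rho>: "0 < \<rho>" "\<rho> \<le> 1" and s: "-1 < s" "s < 0"
    and c: "c > 0"
    and low: "AE x in \<nu>. \<forall>y>0. c * (y + \<bar>x\<bar>) \<le> norm (of_real y - of_real x * cis (- pi * \<rho>))"
    and surj: "\<And>y. 0 < y \<Longrightarrow> \<exists>u. 0 < u \<and> u < 1 \<and> ray_param \<alpha> u = y"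
    and ray: "\<And>u. 0 < u \<Longrightarrow> u < 1 \<Longrightarrow>
      (LINT x|\<nu>. 1 / (of_real (ray_param \<alpha> u) - of_real x * cis (- pi * \<rho>))) = of_real (u powr (1 / \<alpha>))"
    and ray_abs: "\<And>u. 0 < u \<Longrightarrow> u < 1 \<Longrightarrow>
      (\<integral>\<^sup>+x. ennreal (ray_param \<alpha> u / (norm (of_real (ray_param \<alpha> u) - of_real x * cis (- pi * \<rho>)))\<^sup>2) \<partial>\<nu>) \<le> ennreal (u powr (1 / \<alpha>))"
  shows "has_bochner_integral \<nu> (\<lambda>x. indicator {0<..} x * x powr s)
    (1 / pi * sin (pi * \<rho> * s) * (Gamma s * Gamma (1 - s / \<alpha>) / Gamma (2 + s - s / \<alpha>)))"
proof -
  interpret prob_space \<nu> by fact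
  interpret P: pair_sigma_finite \<nu> "lborel :: real measure" ..
  define \<omega> where "\<omega> = cis (- pi * \<rho>)"
  define q where "q y = Re (LINT x|\<nu>. 1 / (of_real y - of_real x * \<omega>))" for y
  define G where "G = Gamma s * Gamma (1 - s / \<alpha>) / Gamma (2 + s - s / \<alpha>)"
  have [measurable]: "q \<in> borel_measurable borel"
    unfolding q_def by measurable
  have q_ray: "q (ray_param \<alpha> u) = u powr (1 / \<alpha>)" if "0 < u" "u < 1" for u
    using ray[OF that] by (simp add: q_def \<omega>_def)
  have q_nonneg: "q y \<ge> 0" if "y > 0" for y
    using surj[OF that] q_ray by fastforce
  have q_complex: "(LINT x|\<nu>. 1 / (of_real y - of_real x * \<omega>)) = of_real (q y)" if "y > 0" for y
    using surj[OF that] ray q_ray by (force simp: \<omega>_def)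
  have q_abs: "(\<integral>\<^sup>+x. ennreal (y / (norm (of_real y - of_real x * \<omega>))\<^sup>2) \<partial>\<nu>) \<le> ennreal (q y)" if "y > 0" for y
    using surj[OF that] ray_abs q_ray by (force simp: \<omega>_def)
  have J_int: "set_integrable lborel {0<..} (\<lambda>y. y powr s * q y)"
    and J_val: "(LBINT y:{0<..}. y powr s * q y) = - G"
    unfolding G_def by (rule mellin_ray_param[OF \<alpha> s _ q_ray surj]; simp)+
  have norm_upper: "norm (of_real y - of_real x * \<omega>) \<le> y + \<bar>x\<bar>" if "y > 0" for x y
    using norm_triangle_ineq4[of "of_real y" "of_real x * \<omega>"] that by (simp add: norm_mult \<omega>_def)
  have off_cut: "AE x in \<nu>. x \<noteq> 0 \<longrightarrow> - of_real x * \<omega> \<notin> \<real>\<^sub>\<le>\<^sub>0"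
    using low
  proof eventually_elim
    case (elim x)
    show ?case
    proof (intro impI notI)
      assume "x \<noteq> 0" and cut: "- of_real x * \<omega> \<in> \<real>\<^sub>\<le>\<^sub>0"
      obtain r where r: "- of_real x * \<omega> = of_real r" "r \<le> 0" 
        by (rule nonpos_Reals_cases[OF cut])
      have "r \<noteq> 0" using r \<open>x \<noteq> 0\<close> by (auto simp: \<omega>_def)
      with r have "c * (- r + \<bar>x\<bar>) \<le> norm (of_real (- r) - of_real x * \<omega>)"
        using elim[rule_format, of "- r"] by (simp add: \<omega>_def)
      also have "of_real (- r) - of_real x * \<omega> = 0" by (simp add: r(1)[symmetric])
      finally show False using c \<open>r \<noteq> 0\<close> r(2) by (auto simp: mult_le_0_iff)
    qed
  qed
  have null0: "AE x in \<nu>. x \<noteq> 0"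
  proof -
    \<comment> \<open>an atom at \<open>0\<close> would make \<open>q y\<close> at least its mass over \<open>y\<close>, while \<open>y * q y = 1 - u\<close> tends to \<open>0\<close>\<close>
    have mass0: "prob {0} \<le> 1 - u" if u: "0 < u" "u < 1" for u
    proof -
      define y where "y = ray_param \<alpha> u"
      have y: "y > 0" using ray_param_pos u by (simp add: y_def)
      have "ennreal (1 / y) * emeasure \<nu> {0} = (\<integral>\<^sup>+x. ennreal (1 / y) * indicator {0} x \<partial>\<nu>)"
        by (rule nn_integral_cmult_indicator[symmetric]) simp
      also have "\<dots> \<le> (\<integral>\<^sup>+x. ennreal (y / (norm (of_real y - of_real x * \<omega>))\<^sup>2) \<partial>\<nu>)"
        using y by (intro nn_integral_mono) (auto simp: indicator_def power2_eq_square)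
      also have "\<dots> \<le> ennreal (q y)" by (rule q_abs[OF y])
      finally have "ennreal (1 / y * prob {0}) \<le> ennreal (q y)"
        by (subst ennreal_mult') (use y in \<open>simp_all add: emeasure_eq_measure\<close>)
      then have "1 / y * prob {0} \<le> q y" using q_nonneg[OF y] by (simp add: ennreal_le_iff)
      then have "prob {0} \<le> q y * y" using y by (simp add: field_simps)
      also have "q y * y = (u powr (1 / \<alpha>) * u powr (- 1 / \<alpha>)) * (1 - u)"
        using q_ray[OF u] by (simp add: y_def ray_param_def)
      also have "u powr (1 / \<alpha>) * u powr (- 1 / \<alpha>) = 1"
        using u by (simp flip: powr_add)
      finally show ?thesis by simp
    qed
    have "prob {0} \<le> 0 + e" if "e > 0" for e
    proof (cases "e < 1")
      case True
      then show ?thesis using mass0[of "1 - e"] that by simp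
    next
      case False
      then show ?thesis using prob_le_1[of "{0}"] by linarith
    qed
    then have "prob {0} \<le> 0" by (rule field_le_epsilon)
    then have "emeasure \<nu> {0} = 0" by (simp add: emeasure_eq_measure measure_le_0_iff)
    then show ?thesis by (intro AE_I[of _ _ "{0}"]) auto
  qed
  \<comment> \<open>the interval from \<open>\<bar>x\<bar>\<close> to \<open>2 \<bar>x\<bar>\<close> alone contributes this much\<close>
  have lower_T: "ennreal (\<bar>x\<bar> powr s / 9) \<le> (\<integral>\<^sup>+y. ennreal (indicator {0<..} y * (y powr (s + 1) / (y + \<bar>x\<bar>)\<^sup>2)) \<partial>lborel)" for x
  proof (cases "x = 0")
    case False
    define t where "t = \<bar>x\<bar>"
    have t: "t > 0" using False by (simp add: t_def)
    have "t * (t powr (s + 1) / (3 * t)\<^sup>2) = t powr s / 9"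
      using t by (simp add: powr_add power2_eq_square)
    then have "ennreal (\<bar>x\<bar> powr s / 9) = ennreal (t powr (s + 1) / (3 * t)\<^sup>2) * emeasure lborel {t..2*t}"
      using t by (simp add: ennreal_mult'[symmetric] mult.commute flip: t_def)
    also have "\<dots> = (\<integral>\<^sup>+y. ennreal (t powr (s + 1) / (3 * t)\<^sup>2) * indicator {t..2*t} y \<partial>lborel)"
      by (rule nn_integral_cmult_indicator[symmetric]) simp
    also have "\<dots> \<le> (\<integral>\<^sup>+y. ennreal (indicator {0<..} y * (y powr (s + 1) / (y + \<bar>x\<bar>)\<^sup>2)) \<partial>lborel)"
    proof (intro nn_integral_mono)
      fix y :: real
      show "ennreal (t powr (s + 1) / (3 * t)\<^sup>2) * indicator {t..2*t} y \<le> ennreal (indicator {0<..} y * (y powr (s + 1) / (y + \<bar>x\<bar>)\<^sup>2))"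
      proof (cases "y \<in> {t..2*t}")
        case True
        then have y: "t \<le> y" "y \<le> 2 * t" by auto
        have "t powr (s + 1) / (3 * t)\<^sup>2 \<le> y powr (s + 1) / (y + \<bar>x\<bar>)\<^sup>2"
          using y t s by (intro frac_le powr_mono2 power_mono zero_less_power) (auto simp: t_def)
        then show ?thesis using True t by (auto simp: ennreal_leI)
      qed simp
    qed
    finally show ?thesis .
  qed simp
  have abs_moment: "integrable \<nu> (\<lambda>x. \<bar>x\<bar> powr s)"
  proof (rule integrableI_nonneg)
    have "(\<integral>\<^sup>+x. ennreal (\<bar>x\<bar> powr s / 9) \<partial>\<nu>)
      \<le> (\<integral>\<^sup>+x. \<integral>\<^sup>+y. ennreal (indicator {0<..} y * (y powr (s + 1) / (y + \<bar>x\<bar>)\<^sup>2)) \<partial>lborel \<partial>\<nu>)"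
      by (intro nn_integral_mono lower_T)
    also have "\<dots> = (\<integral>\<^sup>+y. \<integral>\<^sup>+x. ennreal (indicator {0<..} y * (y powr (s + 1) / (y + \<bar>x\<bar>)\<^sup>2)) \<partial>\<nu> \<partial>lborel)"
      by (rule P.Fubini'[symmetric]) measurable
    also have "\<dots> \<le> (\<integral>\<^sup>+y. ennreal (indicator {0<..} y *\<^sub>R (y powr s * q y)) \<partial>lborel)"
    proof (intro nn_integral_mono)
      fix y :: real
      show "(\<integral>\<^sup>+x. ennreal (indicator {0<..} y * (y powr (s + 1) / (y + \<bar>x\<bar>)\<^sup>2)) \<partial>\<nu>) \<le> ennreal (indicator {0<..} y *\<^sub>R (y powr s * q y))"
      proof (cases "y > 0")
        case True
        have "AE x in \<nu>. ennreal (indicator {0<..} y * (y powr (s + 1) / (y + \<bar>x\<bar>)\<^sup>2)) \<le> ennreal (y powr s) * ennreal (y / (norm (of_real y - of_real x * \<omega>))\<^sup>2)"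
          using low
        proof eventually_elim
          case (elim x)
          have "0 < c * (y + \<bar>x\<bar>)" using c True by (intro mult_pos_pos) auto
          then have "0 < norm (of_real y - of_real x * \<omega>)"
            using elim True unfolding \<omega>_def by (meson less_le_trans)
          then have "y / (y + \<bar>x\<bar>)\<^sup>2 \<le> y / (norm (of_real y - of_real x * \<omega>))\<^sup>2"
            using True norm_upper[OF True, of x] by (intro divide_left_mono power_mono mult_pos_pos zero_less_power) auto
          then have "y powr s * (y / (y + \<bar>x\<bar>)\<^sup>2) \<le> y powr s * (y / (norm (of_real y - of_real x * \<omega>))\<^sup>2)"
            by (rule mult_left_mono) simp
          then show ?case using True by (simp add: ennreal_mult'[symmetric] powr_add ennreal_leI)
        qed
        then have "(\<integral>\<^sup>+x. ennreal (indicator {0<..} y * (y powr (s + 1) / (y + \<bar>x\<bar>)\<^sup>2)) \<partial>\<nu>)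
          \<le> (\<integral>\<^sup>+x. ennreal (y powr s) * ennreal (y / (norm (of_real y - of_real x * \<omega>))\<^sup>2) \<partial>\<nu>)"
          by (rule nn_integral_mono_AE)
        also have "\<dots> = ennreal (y powr s) * (\<integral>\<^sup>+x. ennreal (y / (norm (of_real y - of_real x * \<omega>))\<^sup>2) \<partial>\<nu>)"
          by (rule nn_integral_cmult) measurable
        also have "\<dots> \<le> ennreal (y powr s) * ennreal (q y)"
          by (intro mult_left_mono q_abs True) simp
        finally show ?thesis using True by (simp add: ennreal_mult')
      qed simp
    qed
    also have "\<dots> < \<infinity>"
      using J_int q_nonneg unfolding set_integrable_def
      by (subst nn_integral_eq_integral) (auto simp: indicator_def)
    finally have "(\<integral>\<^sup>+x. ennreal (1 / 9) * ennreal (\<bar>x\<bar> powr s) \<partial>\<nu>) < \<infinity>"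
      by (simp add: ennreal_mult'[symmetric])
    then show "(\<integral>\<^sup>+x. ennreal (\<bar>x\<bar> powr s) \<partial>\<nu>) < \<infinity>"
      by (subst (asm) nn_integral_cmult) (auto simp: ennreal_mult_less_top)
  qed auto
  define B where "B = - (pi / sin (pi * s))"
  define k where "k = (\<lambda>(x, y). indicator {0<..} y *\<^sub>R (complex_of_real (y powr s) / (of_real y - of_real x * \<omega>)))"
  have k_meas: "k \<in> borel_measurable (\<nu> \<Otimes>\<^sub>M lborel)"
    unfolding k_def by measurable
  \<comment> \<open>\<open>(- x / \<omega>) powr s\<close>, with the principal argument worked out for either sign of \<open>x\<close>\<close>
  define p where "p x = complex_of_real (\<bar>x\<bar> powr s) * (if x > 0 then cis (pi * (1 - \<rho>) * s) else cis (- pi * \<rho> * s))" for x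
  have p_meas [measurable]: "p \<in> borel_measurable \<nu>"
    unfolding p_def by measurable
  have p_eq: "(- of_real x * \<omega>) powr of_real s = p x" if "x \<noteq> 0" "- of_real x * \<omega> \<notin> \<real>\<^sub>\<le>\<^sub>0" for x
  proof (cases "x > 0")
    case True
    have "- of_real x * \<omega> = of_real x * cis (pi * (1 - \<rho>))"
    proof -
      have "cis (pi * (1 - \<rho>)) = cis pi * cis (- pi * \<rho>)"
        unfolding cis_mult by (simp add: algebra_simps)
      then show ?thesis by (simp add: \<omega>_def)
    qed
    moreover have "0 \<le> pi * (1 - \<rho>)" "pi * (1 - \<rho>) \<le> pi" using \<rho> by auto
    ultimately show ?thesis
      using True powr_polar[of x "pi * (1 - \<rho>)" s] pi_gt_zero by (simp only: p_def) simp
  next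
    case False
    have "cis (- pi) = -1" by (simp add: complex_eq_iff)
    then have "\<rho> \<noteq> 1" using that False by (auto simp: \<omega>_def)
    then have "- pi < - pi * \<rho>" "- pi * \<rho> \<le> pi" using \<rho> by (auto simp: algebra_simps intro: order_trans[of _ 0])
    moreover have "- of_real x * \<omega> = of_real \<bar>x\<bar> * cis (- pi * \<rho>)" using False by (simp add: \<omega>_def)
    ultimately show ?thesis
      using False that powr_polar[of "\<bar>x\<bar>" "- pi * \<rho>" s] by (simp only: p_def) simp
  qed
  have inner: "AE x in \<nu>. integrable lborel (\<lambda>y. k (x, y)) \<and> (LINT y|lborel. k (x, y)) = of_real B * p x"
    using off_cut null0
  proof eventually_elim
    case (elim x)
    then have z: "- of_real x * \<omega> \<notin> \<real>\<^sub>\<le>\<^sub>0" by simp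
    show ?case
      using stieltjes_kernel_integrable[OF s z] stieltjes_kernel[OF s z] p_eq[OF elim(2) z]
      by (simp add: k_def set_integrable_def set_lebesgue_integral_def B_def)
  qed
  have k_norm: "AE x in \<nu>. (LINT y|lborel. norm (k (x, y))) \<le> (B / c) * \<bar>x\<bar> powr s"
    using inner low null0
  proof eventually_elim
    case (elim x)
    have "set_integrable lborel {0<..} (\<lambda>y. y powr s / (y + \<bar>x\<bar>))"
      by (rule stieltjes_kernel_real(1)[OF s]) (use elim(3) in simp)
    moreover have "(LBINT y:{0<..}. y powr s / (y + \<bar>x\<bar>)) = B * \<bar>x\<bar> powr s"
      unfolding B_def by (rule stieltjes_kernel_real(2)[OF s]) (use elim(3) in simp)
    ultimately have hb: "has_bochner_integral lborel (\<lambda>y. (1 / c) * (indicator {0<..} y *\<^sub>R (y powr s / (y + \<bar>x\<bar>)))) ((1 / c) * (B * \<bar>x\<bar> powr s))"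
      unfolding set_integrable_def set_lebesgue_integral_def
      by (intro has_bochner_integral_mult_right) (auto simp: has_bochner_integral_iff)
    have "(LINT y|lborel. norm (k (x, y))) \<le> (LINT y|lborel. (1 / c) * (indicator {0<..} y *\<^sub>R (y powr s / (y + \<bar>x\<bar>))))"
    proof (rule integral_mono)
      show "integrable lborel (\<lambda>y. norm (k (x, y)))" using elim(1) by simp
      show "integrable lborel (\<lambda>y. (1 / c) * (indicator {0<..} y *\<^sub>R (y powr s / (y + \<bar>x\<bar>))))"
        using hb by (simp add: has_bochner_integral_iff)
      fix y :: real
      show "norm (k (x, y)) \<le> (1 / c) * (indicator {0<..} y *\<^sub>R (y powr s / (y + \<bar>x\<bar>)))"
      proof (cases "y > 0")
        case True
        have pos: "0 < c * (y + \<bar>x\<bar>)" using c True by (intro mult_pos_pos) auto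
        have le: "c * (y + \<bar>x\<bar>) \<le> norm (of_real y - of_real x * \<omega>)" using elim(2) True by (simp add: \<omega>_def)
        have "y powr s / norm (of_real y - of_real x * \<omega>) \<le> y powr s / (c * (y + \<bar>x\<bar>))"
          using pos le by (intro divide_left_mono mult_pos_pos[of _ "c * (y + \<bar>x\<bar>)"]) (auto intro: less_le_trans simp del: zero_less_norm_iff)
        then show ?thesis using True by (simp add: k_def norm_divide)
      qed (simp add: k_def)
    qed
    also have "\<dots> = (B / c) * \<bar>x\<bar> powr s" using hb by (simp add: has_bochner_integral_iff)
    finally show ?case .
  qed
  have k_int: "integrable (\<nu> \<Otimes>\<^sub>M lborel) k"
  proof (rule P.Fubini_integrable[OF k_meas])
    show "AE x in \<nu>. integrable lborel (\<lambda>y. k (x, y))" using inner by eventually_elim simp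
    show "integrable \<nu> (\<lambda>x. LINT y|lborel. norm (k (x, y)))"
    proof (rule Bochner_Integration.integrable_bound)
      show "integrable \<nu> (\<lambda>x. (B / c) * \<bar>x\<bar> powr s)" using abs_moment by (rule integrable_mult_right)
      show "AE x in \<nu>. norm (LINT y|lborel. norm (k (x, y))) \<le> norm ((B / c) * \<bar>x\<bar> powr s)"
        using k_norm
      proof eventually_elim
        case (elim x)
        moreover have "0 \<le> (LINT y|lborel. norm (k (x, y)))" by simp
        ultimately show ?case by (metis abs_of_nonneg order_trans real_norm_def)
      qed
    qed (use k_meas in measurable)
  qed
  have "complex_of_real (- G) = (LINT y|lborel. complex_of_real (indicator {0<..} y *\<^sub>R (y powr s * q y)))"
    using J_val by (simp only: set_lebesgue_integral_def integral_complex_of_real)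
  also have "\<dots> = (LINT y|lborel. LINT x|\<nu>. k (x, y))"
  proof (intro Bochner_Integration.integral_cong refl)
    fix y :: real
    show "complex_of_real (indicator {0<..} y *\<^sub>R (y powr s * q y)) = (LINT x|\<nu>. k (x, y))"
    proof (cases "y > 0")
      case True
      have "(LINT x|\<nu>. k (x, y)) = (LINT x|\<nu>. complex_of_real (y powr s) * (1 / (of_real y - of_real x * \<omega>)))"
        using True by (simp add: k_def)
      also have "\<dots> = complex_of_real (y powr s) * of_real (q y)"
        unfolding q_complex[OF True, symmetric] by (rule integral_mult_right_zero)
      finally show ?thesis using True by simp
    qed (simp add: k_def)
  qed
  also have "\<dots> = (LINT x|\<nu>. LINT y|lborel. k (x, y))"
    using P.Fubini_integral[of "\<lambda>x y. k (x, y)"] k_int by simp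
  also have "\<dots> = (LINT x|\<nu>. of_real B * p x)"
    by (rule integral_cong_AE) (use k_meas inner in \<open>auto\<close>)
  finally have main: "complex_of_real (- G) = of_real B * (LINT x|\<nu>. p x)"
    by simp
  have p_int: "integrable \<nu> p"
    by (rule Bochner_Integration.integrable_bound[OF abs_moment]) (auto simp: p_def norm_mult)
  \<comment> \<open>the phase \<open>cis (\<pi>\<rho>s)\<close> makes the contribution of negative \<open>x\<close> real\<close>
  have Im_p: "Im (cis (pi * \<rho> * s) * p x) = sin (pi * s) * (indicator {0<..} x * x powr s)" for x
  proof -
    have "cis (pi * \<rho> * s) * cis (pi * (1 - \<rho>) * s) = cis (pi * s)"
      by (simp add: cis_mult algebra_simps)
    moreover have "cis (pi * \<rho> * s) * cis (- pi * \<rho> * s) = 1"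
      by (simp add: cis_mult)
    moreover have "cis (pi * \<rho> * s) * p x = of_real (\<bar>x\<bar> powr s) *
       (if x > 0 then cis (pi * \<rho> * s) * cis (pi * (1 - \<rho>) * s) else cis (pi * \<rho> * s) * cis (- pi * \<rho> * s))"
      by (simp add: p_def)
    ultimately have "cis (pi * \<rho> * s) * p x = of_real (\<bar>x\<bar> powr s) * (if x > 0 then cis (pi * s) else 1)"
      by simp
    then show ?thesis by simp
  qed
  have moment_int: "integrable \<nu> (\<lambda>x. indicator {0<..} x * x powr s)"
    by (rule Bochner_Integration.integrable_bound[OF abs_moment]) (auto simp: indicator_def)
  have "Im (cis (pi * \<rho> * s) * of_real (- G)) = B * Im (LINT x|\<nu>. cis (pi * \<rho> * s) * p x)"
    unfolding main by (simp add: algebra_simps)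
  also have "Im (LINT x|\<nu>. cis (pi * \<rho> * s) * p x) = (LINT x|\<nu>. sin (pi * s) * (indicator {0<..} x * x powr s))"
    using p_int by (simp only: integral_Im[symmetric] integrable_mult_right Im_p)
  also have "B * \<dots> = - pi * (LINT x|\<nu>. indicator {0<..} x * x powr s)"
  proof -
    have "0 < pi * (- s)" "pi * (- s) < pi * 1"
      using s by (intro mult_pos_pos mult_strict_left_mono; simp)+
    then have "sin (pi * (- s)) > 0" by (intro sin_gt_zero) auto
    then show ?thesis by (simp add: B_def)
  qed
  finally have "(LINT x|\<nu>. indicator {0<..} x * x powr s) = 1 / pi * sin (pi * \<rho> * s) * G"
    by (simp add: field_simps)
  then show ?thesis
    using moment_int by (simp add: has_bochner_integral_iff G_def)
qed

section \<open>The Cauchy transform of a free stable law\<close>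

lemma integrable_cauchy_kernel:
  assumes "prob_space \<nu>" and [measurable_cong]: "sets \<nu> = sets borel" and z: "Im z > 0"
  shows "integrable \<nu> (\<lambda>x. 1 / (z - complex_of_real x))"
proof -
  interpret prob_space \<nu> by fact
  have "norm (1 / (z - complex_of_real x)) \<le> 1 / Im z" for x
  proof -
    have "Im z \<le> norm (z - of_real x)"
      using abs_Im_le_cmod[of "z - of_real x"] by simp
    then show ?thesis using z by (simp add: norm_divide frac_le)
  qed
  then show ?thesis
    by (intro integrable_const_bound[where B = "1 / Im z"]) auto
qed

lemma Im_cauchy_transform_neg:
  assumes "prob_space \<nu>" and [measurable_cong]: "sets \<nu> = sets borel" and z: "Im z > 0"
  shows "Im (cauchy_transform \<nu> z) < 0"
proof -
  interpret prob_space \<nu> by fact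
  note int = integrable_cauchy_kernel[OF assms]
  have "Im (1 / (z - complex_of_real x)) < 0" for x
  proof -
    have "Im (z - of_real x) > 0" using z by simp
    then have "z - of_real x \<noteq> 0" by force
    then show ?thesis
      using z by (auto simp: Im_divide intro!: divide_pos_pos add_nonneg_pos zero_less_power)
  qed
  then have "(LINT x|\<nu>. Im (1 / (z - complex_of_real x))) < 0"
    using int by (intro expectation_less AE_I2 integrable_Im) auto
  then show ?thesis
    using int by (simp add: cauchy_transform_def)
qed

text \<open>
  The defining equation in polar coordinates for \<open>1 / G z\<close>, with angles measured from the direction \<open>cis (\<pi>\<rho>)\<close>.
  Rotating by that direction removes the constant \<open>cis (\<pi>\<alpha>\<rho>)\<close>, so \<open>\<rho>\<close> enters the
  right-hand side only through the range of \<open>\<delta>\<close>.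
\<close>

lemma free_stable_polar:
  assumes fs: "is_free_stable \<alpha> \<rho> \<nu>" and z: "Im z > 0"
  obtains R \<delta> where "R > 0" "- pi * \<rho> < \<delta>" "\<delta> < pi * (1 - \<rho>)"
    "cauchy_transform \<nu> z = 1 / (of_real R * cis (\<delta> + pi * \<rho>))"
    "z * cis (- pi * \<rho>) = of_real R * cis \<delta> - of_real (R powr (1 - \<alpha>)) * cis ((1 - \<alpha>) * \<delta>)"
proof -
  define G where "G = cauchy_transform \<nu> z"
  define Z where "Z = 1 / G"
  have ImG: "Im G < 0"
    using Im_cauchy_transform_neg[of \<nu> z] fs z by (auto simp: is_free_stable_def G_def)
  then have "G \<noteq> 0" by force
  then have Z: "Im Z > 0"
    using ImG by (simp add: Z_def Im_divide complex_neq_0 divide_neg_pos)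
  define R \<theta> where "R = norm Z" and "\<theta> = Arg Z"
  have "Z \<noteq> 0" using Z by force
  then have R: "R > 0" by (simp add: R_def)
  have \<theta>: "0 < \<theta>" "\<theta> < pi" using Z Arg_lt_pi[of Z] by (simp_all add: \<theta>_def)
  have Z_polar: "Z = of_real R * cis \<theta>"
    unfolding R_def \<theta>_def using rcis_cmod_Arg[of Z] by (simp add: rcis_def)
  have "Z powr of_real (- \<alpha> + 1) = of_real (R powr (1 - \<alpha>)) * cis (\<theta> * (1 - \<alpha>))"
    unfolding Z_polar using powr_polar[of R \<theta> "- \<alpha> + 1"] R \<theta> by (simp add: add.commute)
  then have phi: "free_stable_phi \<alpha> \<rho> Z = - (cis (pi * \<alpha> * \<rho>) * (of_real (R powr (1 - \<alpha>)) * cis (\<theta> * (1 - \<alpha>))))"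
    unfolding free_stable_phi_def by (simp add: cis_conv_exp mult_ac)
  have "z = Z + free_stable_phi \<alpha> \<rho> Z"
    using fs z by (simp add: is_free_stable_def has_voiculescu_transform_def Z_def G_def)
  also have "\<dots> = of_real R * cis \<theta> - cis (pi * \<alpha> * \<rho>) * (of_real (R powr (1 - \<alpha>)) * cis (\<theta> * (1 - \<alpha>)))"
    by (subst phi) (simp add: Z_polar[symmetric])
  finally have "z * cis (- pi * \<rho>) = (of_real R * cis \<theta> - cis (pi * \<alpha> * \<rho>) * (of_real (R powr (1 - \<alpha>)) * cis (\<theta> * (1 - \<alpha>)))) * cis (- pi * \<rho>)"
    by (rule arg_cong)
  also have "\<dots> = of_real R * (cis \<theta> * cis (- pi * \<rho>))
      - of_real (R powr (1 - \<alpha>)) * (cis (pi * \<alpha> * \<rho>) * cis (\<theta> * (1 - \<alpha>)) * cis (- pi * \<rho>))"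
    by (simp add: algebra_simps)
  also have "cis \<theta> * cis (- pi * \<rho>) = cis (\<theta> - pi * \<rho>)"
    by (simp only: cis_mult) simp
  also have "cis (pi * \<alpha> * \<rho>) * cis (\<theta> * (1 - \<alpha>)) * cis (- pi * \<rho>) = cis ((1 - \<alpha>) * (\<theta> - pi * \<rho>))"
    by (simp only: cis_mult) (simp add: algebra_simps)
  finally have "z * cis (- pi * \<rho>) = of_real R * cis (\<theta> - pi * \<rho>) - of_real (R powr (1 - \<alpha>)) * cis ((1 - \<alpha>) * (\<theta> - pi * \<rho>))" .
  moreover have "cauchy_transform \<nu> z = 1 / (of_real R * cis (\<theta> - pi * \<rho> + pi * \<rho>))"
    by (simp add: Z_polar[symmetric]) (simp add: Z_def G_def)
  ultimately show ?thesis
    using that[of R "\<theta> - pi * \<rho>"] R \<theta> by (simp add: algebra_simps)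
qed

text \<open>
  Since \<open>y > 0\<close> forces \<open>R > 1\<close>, the choice \<open>u = R powr (- \<alpha>)\<close> lies in the unit interval.
\<close>

lemma ray_param_of_modulus:
  assumes \<alpha>: "0 < \<alpha>" and R: "R > 0" "R - R powr (1 - \<alpha>) = y" and y: "y > 0"
  obtains u where "0 < u" "u < 1" "ray_param \<alpha> u = y" "u powr (1 / \<alpha>) = 1 / R"
proof -
  have R1: "R > 1"
  proof (rule ccontr)
    assume "\<not> R > 1"
    then have "R powr 1 \<le> R powr (1 - \<alpha>)" using R \<alpha> by (intro powr_mono') auto
    then show False using R y by simp
  qed
  show ?thesis
  proof (rule that[of "R powr (- \<alpha>)"])
    show "0 < R powr - \<alpha>" using R by simp
    show "R powr - \<alpha> < 1" using R1 \<alpha> by (simp add: powr_less_one)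
    show "(R powr - \<alpha>) powr (1 / \<alpha>) = 1 / R"
      unfolding powr_powr using \<alpha> R by (simp add: powr_minus_divide)
    have "ray_param \<alpha> (R powr - \<alpha>) = R * (1 - R powr - \<alpha>)"
      using \<alpha> R by (simp add: ray_param_def powr_powr)
    also have "\<dots> = R - R powr (1 - \<alpha>)"
      using R by (simp add: right_diff_distrib powr_diff powr_minus divide_inverse)
    finally show "ray_param \<alpha> (R powr - \<alpha>) = y" using R by simp
  qed
qed

text \<open>
  Eliminating \<open>R\<close> from the real and imaginary parts gives
  \<open>y sin \<delta> = - R powr (1 - \<alpha>) sin (\<alpha> \<delta>)\<close>. Within the stated range of angles both sines have the sign
  of \<open>\<delta>\<close>, so the two sides have opposite signs unless \<open>\<delta> = 0\<close>.
\<close>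

lemma angle_eq_zero_on_ray:
  assumes y: "y > 0" and \<alpha>: "0 < \<alpha>" and "R > 0"
    and \<delta>: "\<bar>\<delta>\<bar> < pi" "\<alpha> * \<bar>\<delta>\<bar> < pi"
    and eq: "of_real y = of_real R * cis \<delta> - of_real (R powr (1 - \<alpha>)) * cis ((1 - \<alpha>) * \<delta>)"
  shows "\<delta> = 0"
proof (rule ccontr)
  assume "\<delta> \<noteq> 0"
  define R' where "R' = R powr (1 - \<alpha>)"
  have R': "R' > 0" using \<open>R > 0\<close> by (simp add: R'_def)
  have Re: "y = R * cos \<delta> - R' * cos ((1 - \<alpha>) * \<delta>)" and Im: "R * sin \<delta> = R' * sin ((1 - \<alpha>) * \<delta>)"
    using arg_cong[OF eq, of Re] arg_cong[OF eq, of Im] by (simp_all add: R'_def)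
  have "y * sin \<delta> = (R * sin \<delta>) * cos \<delta> - R' * cos ((1 - \<alpha>) * \<delta>) * sin \<delta>"
    by (subst Re) (simp add: algebra_simps)
  also have "\<dots> = R' * sin ((1 - \<alpha>) * \<delta> - \<delta>)"
    unfolding Im sin_diff by (simp add: algebra_simps)
  also have "(1 - \<alpha>) * \<delta> - \<delta> = - (\<alpha> * \<delta>)"
    by (simp add: algebra_simps)
  finally have key: "y * sin \<delta> = - (R' * sin (\<alpha> * \<delta>))" by simp
  show False
  proof (cases "\<delta> > 0")
    case True
    then have "y * sin \<delta> > 0" "R' * sin (\<alpha> * \<delta>) > 0"
      using y R' \<alpha> \<delta> by (auto intro!: mult_pos_pos sin_gt_zero)
    then show False using key by simp
  next
    case False
    with \<open>\<delta> \<noteq> 0\<close> have "y * sin (- \<delta>) > 0" "R' * sin (\<alpha> * (- \<delta>)) > 0"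
      using y R' \<alpha> \<delta> by (intro mult_pos_pos sin_gt_zero; simp add: mult_pos_neg)+
    then show False using key by simp
  qed
qed

text \<open>
  Admissibility enters here: for \<open>\<alpha> > 1\<close> both \<open>\<rho>\<close> and \<open>1 - \<rho>\<close> are at most \<open>1 / \<alpha>\<close>, which
  bounds \<open>\<alpha> * \<bar>\<delta>\<bar>\<close> by \<open>\<pi>\<close>.
\<close>

lemma free_stable_on_ray:
  assumes adm: "(\<alpha>, \<rho>) \<in> admissible" and \<rho>: "0 < \<rho>" "\<rho> < 1" and fs: "is_free_stable \<alpha> \<rho> \<nu>" and y: "y > 0"
  obtains u where "0 < u" "u < 1" "ray_param \<alpha> u = y"
    "cauchy_transform \<nu> (of_real y * cis (pi * \<rho>)) = of_real (u powr (1 / \<alpha>)) * cis (- pi * \<rho>)"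
proof -
  have "sin (pi * \<rho>) > 0" using \<rho> by (intro sin_gt_zero) auto
  then have "Im (of_real y * cis (pi * \<rho>)) > 0" using y by simp
  from free_stable_polar[OF fs this] obtain R \<delta> where R: "R > 0"
    and \<delta>: "- pi * \<rho> < \<delta>" "\<delta> < pi * (1 - \<rho>)"
    and G: "cauchy_transform \<nu> (of_real y * cis (pi * \<rho>)) = 1 / (of_real R * cis (\<delta> + pi * \<rho>))"
    and eq: "of_real y * cis (pi * \<rho>) * cis (- pi * \<rho>) = of_real R * cis \<delta> - of_real (R powr (1 - \<alpha>)) * cis ((1 - \<alpha>) * \<delta>)"
    by blast
  have \<alpha>: "0 < \<alpha>" using adm by (auto simp: admissible_def)
  have eq': "of_real y = of_real R * cis \<delta> - of_real (R powr (1 - \<alpha>)) * cis ((1 - \<alpha>) * \<delta>)"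
    using eq by (simp add: mult.assoc cis_mult)
  have "pi * \<rho> < pi * 1" "pi * (1 - \<rho>) < pi * 1" using \<rho> by (intro mult_strict_left_mono; simp)+
  then have d1: "\<bar>\<delta>\<bar> < pi" unfolding abs_less_iff using \<delta> by linarith
  have d2: "\<alpha> * \<bar>\<delta>\<bar> < pi"
  proof (cases "\<alpha> < 1")
    case True
    have "\<alpha> * \<bar>\<delta>\<bar> \<le> 1 * \<bar>\<delta>\<bar>" using True by (intro mult_right_mono) auto
    then show ?thesis using d1 by simp
  next
    case False
    then have "\<rho> \<le> 1 / \<alpha>" "1 - \<rho> \<le> 1 / \<alpha>" using adm by (auto simp: admissible_def inverse_eq_divide)
    then have "pi * \<rho> \<le> pi * (1 / \<alpha>)" "pi * (1 - \<rho>) \<le> pi * (1 / \<alpha>)" by (intro mult_left_mono; simp)+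
    then have "\<bar>\<delta>\<bar> < pi * (1 / \<alpha>)" unfolding abs_less_iff using \<delta> by linarith
    then show ?thesis using \<alpha> by (simp add: field_simps)
  qed
  have "\<delta> = 0" by (rule angle_eq_zero_on_ray[OF y \<alpha> R d1 d2 eq'])
  then have "complex_of_real y = of_real (R - R powr (1 - \<alpha>))" using eq' by simp
  then have "R - R powr (1 - \<alpha>) = y" by (simp only: of_real_eq_iff)
  from ray_param_of_modulus[OF \<alpha> R this y] obtain u where u: "0 < u" "u < 1" "ray_param \<alpha> u = y" "u powr (1 / \<alpha>) = 1 / R" .
  show ?thesis
  proof (rule that[OF u(1-3)])
    show "cauchy_transform \<nu> (of_real y * cis (pi * \<rho>)) = of_real (u powr (1 / \<alpha>)) * cis (- pi * \<rho>)"
      unfolding G u(4) using \<open>\<delta> = 0\<close> by (simp add: divide_inverse flip: cis_inverse)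
  qed
qed

section \<open>One-sided laws: the ray on the real axis\<close>

text \<open>
  Two rotations of the same equation: the imaginary part of its product with \<open>cis (- \<delta>)\<close> contains only
  \<open>sin (\<alpha> \<delta>)\<close>, which is positive, and the real part contains only \<open>cos (\<alpha> \<delta>)\<close>. The former
  makes \<open>\<delta>\<close> small with \<open>\<epsilon>\<close>; the latter keeps \<open>R\<close> away from \<open>0\<close>.
\<close>

lemma boundary_angle_bounds:
  assumes \<alpha>: "0 < \<alpha>" "\<alpha> < 1" and t: "t > 0" and \<epsilon>: "\<epsilon> > 0" and R: "R > 0" and \<delta>: "0 < \<delta>" "\<delta> < pi"
    and Im: "R * sin \<delta> - R powr (1 - \<alpha>) * sin ((1 - \<alpha>) * \<delta>) = \<epsilon>"
    and Re: "R * cos \<delta> - R powr (1 - \<alpha>) * cos ((1 - \<alpha>) * \<delta>) = t"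
  shows "sin \<delta> \<le> \<epsilon> / t" "cos \<delta> > 0" "cos \<delta> \<le> R powr \<alpha>"
proof -
  define R' where "R' = R powr (1 - \<alpha>)"
  have R': "R' > 0" using R by (simp add: R'_def)
  have sd: "sin \<delta> > 0" using \<delta> by (rule sin_gt_zero)
  have \<alpha>\<delta>: "0 < \<alpha> * \<delta>" "\<alpha> * \<delta> \<le> \<delta>" using \<alpha> \<delta> by (auto simp: mult_le_cancel_right1)
  have arg: "\<delta> - (1 - \<alpha>) * \<delta> = \<alpha> * \<delta>" by (simp add: algebra_simps)
  have "\<epsilon> * cos \<delta> - t * sin \<delta> = R' * sin (\<delta> - (1 - \<alpha>) * \<delta>)"
    unfolding Im[symmetric] Re[symmetric] sin_diff R'_def by (simp add: algebra_simps)
  also have "\<dots> > 0"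
  proof -
    have "\<alpha> * \<delta> < pi" using \<alpha>\<delta> \<delta> by linarith
    then have "sin (\<alpha> * \<delta>) > 0" using \<alpha>\<delta> by (intro sin_gt_zero)
    then show ?thesis unfolding arg using R' by simp
  qed
  finally have 1: "t * sin \<delta> < \<epsilon> * cos \<delta>" by simp
  then have "0 < \<epsilon> * cos \<delta>" using t sd by (meson less_trans mult_pos_pos)
  then show c: "cos \<delta> > 0" using \<epsilon> by (simp add: zero_less_mult_iff)
  have "\<epsilon> * cos \<delta> \<le> \<epsilon> * 1" using \<epsilon> by (intro mult_left_mono) auto
  then show "sin \<delta> \<le> \<epsilon> / t" using 1 t by (simp add: field_simps)
  have "t * cos \<delta> + \<epsilon> * sin \<delta> = R * (cos \<delta> * cos \<delta> + sin \<delta> * sin \<delta>) - R' * cos (\<delta> - (1 - \<alpha>) * \<delta>)"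
    unfolding Im[symmetric] Re[symmetric] cos_diff R'_def by (simp add: algebra_simps del: sin_cos_squared_add3)
  moreover have "0 < t * cos \<delta> + \<epsilon> * sin \<delta>"
    using t c \<epsilon> sd by (intro add_pos_pos mult_pos_pos)
  ultimately have "R - R' * cos (\<alpha> * \<delta>) > 0"
    unfolding arg by simp
  moreover have "R = R' * R powr \<alpha>" using R by (simp add: R'_def flip: powr_add)
  ultimately have "R' * cos (\<alpha> * \<delta>) < R' * R powr \<alpha>" by simp
  then have "cos (\<alpha> * \<delta>) < R powr \<alpha>" using R' by simp
  moreover have "cos \<delta> \<le> cos (\<alpha> * \<delta>)" using \<alpha>\<delta> \<delta> by (intro cos_monotone_0_pi_le) auto
  ultimately show "cos \<delta> \<le> R powr \<alpha>" by simp
qed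

text \<open>
  For \<open>\<epsilon> \<le> t / 2\<close> the sine is at most \<open>1 / 2\<close>, hence the cosine at least \<open>1 / 2\<close>, which bounds \<open>R\<close> below
  by a constant.
\<close>

lemma boundary_density_bound:
  fixes \<alpha> t \<epsilon> R \<delta> :: real
  assumes \<alpha>: "0 < \<alpha>" and t: "t > 0" and \<epsilon>: "0 < \<epsilon>" "\<epsilon> \<le> t / 2" and R: "R > 0"
    and b: "sin \<delta> \<le> \<epsilon> / t" "cos \<delta> > 0" "cos \<delta> \<le> R powr \<alpha>" and s0: "sin \<delta> \<ge> 0"
  shows "sin \<delta> / R \<le> 2 powr (1 / \<alpha>) / t * \<epsilon>"
proof -
  have "\<epsilon> / t \<le> 1 / 2" using t \<epsilon> by (simp add: field_simps)
  then have "sin \<delta> \<le> 1 / 2" using b by linarith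
  then have "(sin \<delta>)\<^sup>2 \<le> (1 / 2)\<^sup>2" using s0 by (intro power_mono) auto
  then have "(cos \<delta>)\<^sup>2 \<ge> (1 / 2)\<^sup>2" unfolding cos_squared_eq by (simp add: power_divide)
  then have "cos \<delta> \<ge> 1 / 2" using b(2) by (intro power2_le_imp_le[of "1/2" "cos \<delta>"]) auto
  then have "1 / 2 \<le> R powr \<alpha>" using b by linarith
  then have "(1 / 2) powr (1 / \<alpha>) \<le> (R powr \<alpha>) powr (1 / \<alpha>)" using \<alpha> by (intro powr_mono2) auto
  then have "(1 / 2) powr (1 / \<alpha>) \<le> R" using \<alpha> R by (simp add: powr_powr)
  moreover have "(0::real) < (1 / 2) powr (1 / \<alpha>)" by simp
  ultimately have "sin \<delta> / R \<le> (\<epsilon> / t) / ((1 / 2) powr (1 / \<alpha>))"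
    using b s0 \<epsilon> t by (intro frac_le) auto
  also have "\<dots> = 2 powr (1 / \<alpha>) / t * \<epsilon>"
    by (simp add: powr_divide)
  finally show ?thesis .
qed

text \<open>
  A window of half-width \<open>\<epsilon>\<close> about \<open>t\<close> has mass at most \<open>- 2 \<epsilon> Im G (t + \<i> \<epsilon>)\<close>, because the
  Poisson kernel is at least \<open>1 / (2 \<epsilon>)\<close> on it. If this is of order \<open>\<epsilon>\<^sup>2\<close>, the distribution function has
  derivative \<open>0\<close> at \<open>t\<close>. This elementary part of Stieltjes inversion is enough to exclude mass.
\<close>

lemma cdf_constant_if_no_boundary_density:
  assumes "prob_space \<nu>" and sets_nu [measurable_cong]: "sets \<nu> = sets borel" and S: "open S" "convex S"
    and bound: "\<And>t. t \<in> S \<Longrightarrow> \<exists>K e. e > 0 \<and> (\<forall>\<epsilon>. 0 < \<epsilon> \<and> \<epsilon> \<le> e \<longrightarrow> - Im (cauchy_transform \<nu> (Complex t \<epsilon>)) \<le> K * \<epsilon>)"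
  shows "\<exists>c. \<forall>t\<in>S. cdf \<nu> t = c"
proof (rule has_field_derivative_zero_constant[OF S(2)])
  interpret prob_space \<nu> by fact
  have window: "measure \<nu> {t - \<epsilon>..t + \<epsilon>} \<le> 2 * \<epsilon> * (- Im (cauchy_transform \<nu> (Complex t \<epsilon>)))" if \<epsilon>: "\<epsilon> > 0" for t \<epsilon>
  proof -
    have int: "integrable \<nu> (\<lambda>x. 1 / (Complex t \<epsilon> - complex_of_real x))"
      by (rule integrable_cauchy_kernel) (use assms \<epsilon> in auto)
    have Im_kernel: "- Im (1 / (Complex t \<epsilon> - complex_of_real x)) = \<epsilon> / ((t - x)\<^sup>2 + \<epsilon>\<^sup>2)" for x
      by (simp add: Im_divide power2_eq_square)
    have "measure \<nu> {t - \<epsilon>..t + \<epsilon>} = (LINT x|\<nu>. indicator {t - \<epsilon>..t + \<epsilon>} x)"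
      by simp
    also have "\<dots> \<le> (LINT x|\<nu>. 2 * \<epsilon> * (- Im (1 / (Complex t \<epsilon> - complex_of_real x))))"
    proof (rule integral_mono)
      show "integrable \<nu> (\<lambda>x. 2 * \<epsilon> * (- Im (1 / (Complex t \<epsilon> - complex_of_real x))))"
        using int by (intro integrable_mult_right integrable_minus integrable_Im)
      fix x
      show "indicator {t - \<epsilon>..t + \<epsilon>} x \<le> 2 * \<epsilon> * (- Im (1 / (Complex t \<epsilon> - complex_of_real x)))"
      proof (cases "x \<in> {t - \<epsilon>..t + \<epsilon>}")
        case True
        then have "\<bar>t - x\<bar> \<le> \<epsilon>" by auto
        then have "(t - x)\<^sup>2 \<le> \<epsilon>\<^sup>2" using abs_le_square_iff[of "t - x" \<epsilon>] \<epsilon> by simp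
        then have "(t - x)\<^sup>2 + \<epsilon>\<^sup>2 \<le> 2 * \<epsilon> * \<epsilon>" by (simp add: power2_eq_square)
        moreover have "0 < (t - x)\<^sup>2 + \<epsilon>\<^sup>2" using \<epsilon> by (simp add: add_nonneg_pos)
        ultimately have "1 \<le> 2 * \<epsilon> * \<epsilon> / ((t - x)\<^sup>2 + \<epsilon>\<^sup>2)" by simp
        then show ?thesis using True unfolding Im_kernel by simp
      next
        case False
        then show ?thesis unfolding Im_kernel using \<epsilon> by simp
      qed
    qed (auto intro!: integrable_real_indicator simp: less_top[symmetric])
    also have "\<dots> = 2 * \<epsilon> * (- Im (cauchy_transform \<nu> (Complex t \<epsilon>)))"
      using int by (simp add: cauchy_transform_def)
    finally show ?thesis .
  qed
  fix t assume t: "t \<in> S"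
  from bound[OF t] obtain K e where e: "e > 0" and K: "\<And>\<epsilon>. 0 < \<epsilon> \<Longrightarrow> \<epsilon> \<le> e \<Longrightarrow> - Im (cauchy_transform \<nu> (Complex t \<epsilon>)) \<le> K * \<epsilon>"
    by blast
  have diff: "\<bar>cdf \<nu> (t + k) - cdf \<nu> t\<bar> \<le> 2 * K * \<bar>k\<bar> * \<bar>k\<bar>" if k: "k \<noteq> 0" "\<bar>k\<bar> \<le> e" for k
  proof -
    have "\<bar>cdf \<nu> (t + k) - cdf \<nu> t\<bar> \<le> measure \<nu> {t - \<bar>k\<bar>..t + \<bar>k\<bar>}"
    proof (cases "k > 0")
      case True
      have "{..t + k} - {..t} \<subseteq> {t - \<bar>k\<bar>..t + \<bar>k\<bar>}" using True by auto
      moreover have "measure \<nu> ({..t + k} - {..t}) = cdf \<nu> (t + k) - cdf \<nu> t"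
        unfolding cdf_def using True by (intro finite_measure_Diff) auto
      ultimately show ?thesis
        using finite_measure_mono[of "{..t + k} - {..t}" "{t - \<bar>k\<bar>..t + \<bar>k\<bar>}"]
          measure_nonneg[of \<nu> "{..t + k} - {..t}"] by simp
    next
      case False
      have "{..t} - {..t + k} \<subseteq> {t - \<bar>k\<bar>..t + \<bar>k\<bar>}" using False by auto
      moreover have "measure \<nu> ({..t} - {..t + k}) = cdf \<nu> t - cdf \<nu> (t + k)"
        unfolding cdf_def using False by (intro finite_measure_Diff) auto
      ultimately show ?thesis
        using finite_measure_mono[of "{..t} - {..t + k}" "{t - \<bar>k\<bar>..t + \<bar>k\<bar>}"]
          measure_nonneg[of \<nu> "{..t} - {..t + k}"] by simp
    qed
    also have "\<dots> \<le> 2 * \<bar>k\<bar> * (- Im (cauchy_transform \<nu> (Complex t \<bar>k\<bar>)))"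
      by (rule window) (use k in auto)
    also have "\<dots> \<le> 2 * \<bar>k\<bar> * (K * \<bar>k\<bar>)"
      using k by (intro mult_left_mono K) auto
    finally show ?thesis by (simp add: mult_ac)
  qed
  have "((\<lambda>k. (cdf \<nu> (t + k) - cdf \<nu> t) / k) \<longlongrightarrow> 0) (at 0)"
  proof (rule Lim_null_comparison)
    show "\<forall>\<^sub>F k in at 0. norm ((cdf \<nu> (t + k) - cdf \<nu> t) / k) \<le> 2 * K * \<bar>k\<bar>"
      unfolding eventually_at
    proof (intro exI[of _ e] conjI ballI impI e)
      fix k :: real assume "k \<noteq> 0 \<and> dist k 0 < e"
      then show "norm ((cdf \<nu> (t + k) - cdf \<nu> t) / k) \<le> 2 * K * \<bar>k\<bar>"
        using diff[of k] by (simp add: divide_le_eq)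
    qed
    show "((\<lambda>k. 2 * K * \<bar>k\<bar>) \<longlongrightarrow> 0) (at 0)"
      by (auto intro!: tendsto_eq_intros)
  qed
  then have "(cdf \<nu> has_field_derivative 0) (at t)" by (simp add: DERIV_def)
  then show "(cdf \<nu> has_field_derivative 0) (at t within S)"
    by (rule has_field_derivative_at_within)
qed

lemma free_stable_on_ray_param:
  assumes adm: "(\<alpha>, \<rho>) \<in> admissible" and \<rho>: "0 < \<rho>" "\<rho> < 1" and fs: "is_free_stable \<alpha> \<rho> \<nu>"
    and u: "0 < u" "u < 1"
  shows "cauchy_transform \<nu> (of_real (ray_param \<alpha> u) * cis (pi * \<rho>)) = of_real (u powr (1 / \<alpha>)) * cis (- pi * \<rho>)"
proof -
  have \<alpha>: "0 < \<alpha>" using adm by (auto simp: admissible_def)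
  obtain v where v: "0 < v" "v < 1" "ray_param \<alpha> v = ray_param \<alpha> u"
    "cauchy_transform \<nu> (of_real (ray_param \<alpha> u) * cis (pi * \<rho>)) = of_real (v powr (1 / \<alpha>)) * cis (- pi * \<rho>)"
    using free_stable_on_ray[OF adm \<rho> fs ray_param_pos[OF u]] by blast
  moreover have "v = u"
    using inj_on_ray_param[OF \<alpha>] u v(1-3) by (auto dest: inj_onD)
  ultimately show ?thesis by simp
qed

text \<open>
  For \<open>0 < \<rho> < 1\<close> the ray is not real, and the distance from its point at radius \<open>y\<close> to a real \<open>x\<close> is at least
  \<open>sin (\<pi>\<rho>)\<close> times either of \<open>y\<close> and \<open>\<bar>x\<bar>\<close>. The function \<open>\<omega> G (\<omega> y)\<close> is real; its vanishing imaginary part removes the term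
  with \<open>cos (\<pi>\<rho>)\<close> from its real part and leaves the expectation of the nonnegative kernel.
\<close>

lemma free_stable_moment_interior:
  assumes adm: "(\<alpha>, \<rho>) \<in> admissible" and \<rho>: "0 < \<rho>" "\<rho> < 1" and fs: "is_free_stable \<alpha> \<rho> \<nu>"
    and s: "-1 < s" "s < 0"
  shows "has_bochner_integral \<nu> (\<lambda>x. indicator {0<..} x * x powr s) (moment_formula \<alpha> \<rho> s)"
proof -
  have \<alpha>: "0 < \<alpha>" using adm by (auto simp: admissible_def)
  have prob: "prob_space \<nu>" and sets_nu [measurable_cong]: "sets \<nu> = sets borel"
    using fs by (auto simp: is_free_stable_def)
  define \<sigma> where "\<sigma> = sin (pi * \<rho>)"
  have \<sigma>: "\<sigma> > 0" unfolding \<sigma>_def using \<rho> by (intro sin_gt_zero) auto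
  define W where "W y x = 1 / (complex_of_real y - of_real x * cis (- pi * \<rho>))" for y x
  have unit: "cis (pi * \<rho>) * cis (- pi * \<rho>) = 1" by (simp add: cis_mult)
  have W_eq: "W y x = cis (pi * \<rho>) * (1 / (of_real y * cis (pi * \<rho>) - of_real x))" for y x
  proof -
    have "of_real y * cis (pi * \<rho>) - of_real x = cis (pi * \<rho>) * (of_real y - of_real x * cis (- pi * \<rho>))"
      using unit by (simp add: algebra_simps)
    then show ?thesis by (simp add: W_def)
  qed
  have W_int: "integrable \<nu> (W y)" if "y > 0" for y
    unfolding W_eq using that \<sigma>
    by (intro integrable_mult_right integrable_cauchy_kernel[OF prob sets_nu]) (simp add: \<sigma>_def)
  have W_val: "(LINT x|\<nu>. W (ray_param \<alpha> u) x) = of_real (u powr (1 / \<alpha>))" if u: "0 < u" "u < 1" for u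
  proof -
    have "(LINT x|\<nu>. W (ray_param \<alpha> u) x) = cis (pi * \<rho>) * cauchy_transform \<nu> (of_real (ray_param \<alpha> u) * cis (pi * \<rho>))"
      unfolding W_eq cauchy_transform_def by (rule integral_mult_right_zero)
    also have "\<dots> = of_real (u powr (1 / \<alpha>)) * (cis (pi * \<rho>) * cis (- pi * \<rho>))"
      unfolding free_stable_on_ray_param[OF adm \<rho> fs u] by simp
    finally show ?thesis unfolding unit by simp
  qed
  have low1: "y * \<sigma> \<le> norm (of_real y - of_real x * cis (- pi * \<rho>))" if "y > 0" for y x
  proof -
    have "norm (of_real y - of_real x * cis (- pi * \<rho>)) = norm (cis (pi * \<rho>) * (of_real y - of_real x * cis (- pi * \<rho>)))"
      by (simp add: norm_mult)
    also have "cis (pi * \<rho>) * (of_real y - of_real x * cis (- pi * \<rho>)) = of_real y * cis (pi * \<rho>) - of_real x"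
      using unit by (simp add: algebra_simps)
    finally show ?thesis
      using abs_Im_le_cmod[of "of_real y * cis (pi * \<rho>) - of_real x"] that \<sigma> by (simp add: \<sigma>_def)
  qed
  have low2: "\<bar>x\<bar> * \<sigma> \<le> norm (of_real y - of_real x * cis (- pi * \<rho>))" for y x
    using abs_Im_le_cmod[of "of_real y - of_real x * cis (- pi * \<rho>)"] \<sigma> by (simp add: \<sigma>_def abs_mult)
  show ?thesis
    unfolding moment_formula_def
  proof (rule mellin_from_ray[where c = "\<sigma> / 2"])
    show "prob_space \<nu>" "sets \<nu> = sets borel" "0 < \<alpha>" "0 < \<rho>" "\<rho> \<le> 1" "-1 < s" "s < 0" "\<sigma> / 2 > 0"
      using prob sets_nu \<alpha> \<rho> s \<sigma> by auto
    show "AE x in \<nu>. \<forall>y>0. \<sigma> / 2 * (y + \<bar>x\<bar>) \<le> norm (of_real y - of_real x * cis (- pi * \<rho>))"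
    proof (intro AE_I2 allI impI)
      fix x y :: real assume "y > 0"
      from low1[OF this, of x] low2[of x y]
      show "\<sigma> / 2 * (y + \<bar>x\<bar>) \<le> norm (of_real y - of_real x * cis (- pi * \<rho>))"
        by (simp add: algebra_simps)
    qed
    show "\<exists>u>0. u < 1 \<and> ray_param \<alpha> u = y" if "0 < y" for y
      using free_stable_on_ray[OF adm \<rho> fs that] by blast
    show "(LINT x|\<nu>. 1 / (of_real (ray_param \<alpha> u) - of_real x * cis (- pi * \<rho>))) = of_real (u powr (1 / \<alpha>))"
      if "0 < u" "u < 1" for u
      using W_val[OF that] by (simp only: W_def)
    show "(\<integral>\<^sup>+x. ennreal (ray_param \<alpha> u / (norm (of_real (ray_param \<alpha> u) - of_real x * cis (- pi * \<rho>)))\<^sup>2) \<partial>\<nu>) \<le> ennreal (u powr (1 / \<alpha>))"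
      if u: "0 < u" "u < 1" for u
    proof -
      define y where "y = ray_param \<alpha> u"
      have y: "y > 0" unfolding y_def by (rule ray_param_pos[OF u])
      have kernel: "y / (norm (of_real y - of_real x * cis (- pi * \<rho>)))\<^sup>2 = Re (W y x) - cos (pi * \<rho>) / \<sigma> * Im (W y x)" for x
      proof -
        define N where "N = (norm (of_real y - of_real x * cis (- pi * \<rho>)))\<^sup>2"
        have "Re (W y x) = (y - x * cos (pi * \<rho>)) / N" "Im (W y x) = - (x * \<sigma>) / N"
          by (simp_all add: W_def Re_divide Im_divide N_def cmod_power2 \<sigma>_def)
        then show ?thesis
          unfolding N_def[symmetric] using \<sigma> by (simp add: diff_divide_distrib)
      qed
      have "(\<integral>\<^sup>+x. ennreal (y / (norm (of_real y - of_real x * cis (- pi * \<rho>)))\<^sup>2) \<partial>\<nu>)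
          = ennreal (LINT x|\<nu>. Re (W y x) - cos (pi * \<rho>) / \<sigma> * Im (W y x))"
        unfolding kernel
      proof (rule nn_integral_eq_integral)
        show "integrable \<nu> (\<lambda>x. Re (W y x) - cos (pi * \<rho>) / \<sigma> * Im (W y x))"
          using W_int[OF y] by (intro Bochner_Integration.integrable_diff integrable_mult_right integrable_Re integrable_Im)
        show "AE x in \<nu>. 0 \<le> Re (W y x) - cos (pi * \<rho>) / \<sigma> * Im (W y x)"
          unfolding kernel[symmetric] using y by auto
      qed
      also have "(LINT x|\<nu>. Re (W y x) - cos (pi * \<rho>) / \<sigma> * Im (W y x)) = Re (LINT x|\<nu>. W y x) - cos (pi * \<rho>) / \<sigma> * Im (LINT x|\<nu>. W y x)"
        using W_int[OF y] by (simp add: Bochner_Integration.integral_diff integrable_Re integrable_Im)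
      also have "\<dots> = u powr (1 / \<alpha>)"
        unfolding y_def W_val[OF u] by simp
      finally show ?thesis by (simp add: y_def)
    qed
  qed
qed

text \<open>
  The factor \<open>1 - 2 * \<rho>\<close> is \<open>1\<close> for \<open>\<rho> = 0\<close> and \<open>-1\<close> for \<open>\<rho> = 1\<close>, so the point approaches the
  half-line in direction \<open>cis (\<pi>\<rho>)\<close>. For \<open>\<rho> = 1\<close> the angle of \<open>free_stable_polar\<close> is negative; reflecting it
  makes both cases satisfy the same real equations.
\<close>

lemma free_stable_boundary_polar:
  assumes \<alpha>: "0 < \<alpha>" "\<alpha> < 1" and \<rho>: "\<rho> = 0 \<or> \<rho> = 1" and fs: "is_free_stable \<alpha> \<rho> \<nu>"
    and t: "t > 0" and \<epsilon>: "\<epsilon> > 0"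
  obtains R \<delta> where "R > 0" "0 < \<delta>" "\<delta> < pi"
    "cauchy_transform \<nu> (Complex ((1 - 2 * \<rho>) * t) \<epsilon>) = Complex ((1 - 2 * \<rho>) * cos \<delta> / R) (- sin \<delta> / R)"
    "R * cos \<delta> - R powr (1 - \<alpha>) * cos ((1 - \<alpha>) * \<delta>) = t"
    "R * sin \<delta> - R powr (1 - \<alpha>) * sin ((1 - \<alpha>) * \<delta>) = \<epsilon>"
proof -
  have "Im (Complex ((1 - 2 * \<rho>) * t) \<epsilon>) > 0" using \<epsilon> by simp
  from free_stable_polar[OF fs this] obtain R \<delta> where R: "R > 0" "- pi * \<rho> < \<delta>" "\<delta> < pi * (1 - \<rho>)"
    and G: "cauchy_transform \<nu> (Complex ((1 - 2 * \<rho>) * t) \<epsilon>) = 1 / (of_real R * cis (\<delta> + pi * \<rho>))"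
    and eq: "Complex ((1 - 2 * \<rho>) * t) \<epsilon> * cis (- pi * \<rho>) = of_real R * cis \<delta> - of_real (R powr (1 - \<alpha>)) * cis ((1 - \<alpha>) * \<delta>)"
    by blast
  have cis_pi': "cis (- pi) = -1" by (simp add: complex_eq_iff)
  have inv: "1 / (of_real R * cis \<theta>) = Complex (cos \<theta> / R) (- sin \<theta> / R)" for \<theta>
  proof -
    have "1 / (of_real R * cis \<theta>) = of_real (1 / R) * cis (- \<theta>)" by (simp add: divide_inverse)
    then show ?thesis by (simp add: complex_eq_iff)
  qed
  from \<rho> show ?thesis
  proof
    assume 0: "\<rho> = 0"
    show ?thesis
      by (rule that[of R \<delta>]) (use R G 0 inv arg_cong[OF eq, of Re] arg_cong[OF eq, of Im] in auto)
  next
    assume 1: "\<rho> = 1"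
    show ?thesis
    proof (rule that[of R "- \<delta>"])
      show "cauchy_transform \<nu> (Complex ((1 - 2 * \<rho>) * t) \<epsilon>) = Complex ((1 - 2 * \<rho>) * cos (- \<delta>) / R) (- sin (- \<delta>) / R)"
        unfolding G inv using 1 by simp
    qed (use R 1 arg_cong[OF eq, of Re] arg_cong[OF eq, of Im] cis_pi' in auto)
  qed
qed

lemma free_stable_boundary_density:
  assumes \<alpha>: "0 < \<alpha>" "\<alpha> < 1" and \<rho>: "\<rho> = 0 \<or> \<rho> = 1" and fs: "is_free_stable \<alpha> \<rho> \<nu>" and t: "t > 0"
  shows "\<exists>K e. e > 0 \<and> (\<forall>\<epsilon>. 0 < \<epsilon> \<and> \<epsilon> \<le> e \<longrightarrow> - Im (cauchy_transform \<nu> (Complex ((1 - 2 * \<rho>) * t) \<epsilon>)) \<le> K * \<epsilon>)"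
proof (rule exI[where x = "2 powr (1 / \<alpha>) / t"], rule exI[where x = "t / 2"], intro conjI allI impI)
  show "t / 2 > 0" using t by simp
  fix \<epsilon> assume \<epsilon>: "0 < \<epsilon> \<and> \<epsilon> \<le> t / 2"
  then have "\<epsilon> > 0" by simp
  from free_stable_boundary_polar[OF \<alpha> \<rho> fs t this] obtain R \<delta> where R: "R > 0" "0 < \<delta>" "\<delta> < pi"
    and G: "cauchy_transform \<nu> (Complex ((1 - 2 * \<rho>) * t) \<epsilon>) = Complex ((1 - 2 * \<rho>) * cos \<delta> / R) (- sin \<delta> / R)"
    and Re: "R * cos \<delta> - R powr (1 - \<alpha>) * cos ((1 - \<alpha>) * \<delta>) = t"
    and Im: "R * sin \<delta> - R powr (1 - \<alpha>) * sin ((1 - \<alpha>) * \<delta>) = \<epsilon>" by blast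
  note b = boundary_angle_bounds[OF \<alpha> t \<open>\<epsilon> > 0\<close> R Im Re]
  have "sin \<delta> / R \<le> 2 powr (1 / \<alpha>) / t * \<epsilon>"
    by (rule boundary_density_bound[OF \<alpha>(1) t _ _ R(1) b]) (use \<epsilon> sin_gt_zero[OF R(2,3)] in auto)
  then show "- Im (cauchy_transform \<nu> (Complex ((1 - 2 * \<rho>) * t) \<epsilon>)) \<le> 2 powr (1 / \<alpha>) / t * \<epsilon>"
    unfolding G by simp
qed

lemma free_stable_nonpos:
  assumes \<alpha>: "0 < \<alpha>" "\<alpha> < 1" and fs: "is_free_stable \<alpha> 0 \<nu>"
  shows "AE x in \<nu>. x \<le> 0"
proof -
  have prob: "prob_space \<nu>" and sets_nu [measurable_cong]: "sets \<nu> = sets borel"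
    using fs by (auto simp: is_free_stable_def)
  interpret real_distribution \<nu>
    using prob sets_nu by (simp add: real_distribution_def real_distribution_axioms_def)
  obtain c where c: "\<And>t. t > 0 \<Longrightarrow> cdf \<nu> t = c"
    using cdf_constant_if_no_boundary_density[OF prob sets_nu, of "{0<..}"] free_stable_boundary_density[OF \<alpha> _ fs]
    by auto
  have "(cdf \<nu> \<longlongrightarrow> c) at_top"
    by (rule tendsto_eventually[OF eventually_mono[OF eventually_gt_at_top[of 0] c]])
  then have "c = 1" using cdf_lim_at_top_prob tendsto_unique[OF trivial_limit_at_top_linorder] by blast
  have "AE x in \<nu>. \<forall>n. x \<le> 1 / real (Suc n)"
    unfolding AE_all_countable
  proof
    fix n
    have "prob {..1 / real (Suc n)} = 1" using c[of "1 / real (Suc n)"] \<open>c = 1\<close> by (simp add: cdf_def)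
    then have "AE x in \<nu>. x \<in> {..1 / real (Suc n)}" by (rule AE_prob_1)
    then show "AE x in \<nu>. x \<le> 1 / real (Suc n)" by simp
  qed
  then show ?thesis
  proof eventually_elim
    case (elim x)
    show ?case
    proof (rule ccontr)
      assume "\<not> x \<le> 0"
      then obtain n where "inverse (of_nat (Suc n)) < x" using reals_Archimedean[of x] by auto
      with elim[rule_format, of n] show False by (simp add: inverse_eq_divide)
    qed
  qed
qed

lemma free_stable_nonneg:
  assumes \<alpha>: "0 < \<alpha>" "\<alpha> < 1" and fs: "is_free_stable \<alpha> 1 \<nu>"
  shows "AE x in \<nu>. x \<ge> 0"
proof -
  have prob: "prob_space \<nu>" and sets_nu [measurable_cong]: "sets \<nu> = sets borel"
    using fs by (auto simp: is_free_stable_def)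
  interpret real_distribution \<nu>
    using prob sets_nu by (simp add: real_distribution_def real_distribution_axioms_def)
  have "\<exists>K e. e > 0 \<and> (\<forall>\<epsilon>. 0 < \<epsilon> \<and> \<epsilon> \<le> e \<longrightarrow> - Im (cauchy_transform \<nu> (Complex t \<epsilon>)) \<le> K * \<epsilon>)" if "t < 0" for t
    using free_stable_boundary_density[OF \<alpha> _ fs, of "- t"] that by simp
  then obtain c where c: "\<And>t. t < 0 \<Longrightarrow> cdf \<nu> t = c"
    using cdf_constant_if_no_boundary_density[OF prob sets_nu, of "{..<0}"] by auto
  have "(cdf \<nu> \<longlongrightarrow> c) at_bot"
    by (rule tendsto_eventually[OF eventually_mono[OF eventually_gt_at_bot[of 0] c]])
  then have "c = 0" using cdf_lim_at_bot tendsto_unique[OF trivial_limit_at_bot_linorder] by blast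
  have "AE x in \<nu>. \<forall>n. - (1 / real (Suc n)) < x"
    unfolding AE_all_countable
  proof
    fix n
    have "prob {..- (1 / real (Suc n))} = 0" using c[of "- (1 / real (Suc n))"] \<open>c = 0\<close> by (simp add: cdf_def)
    then have "emeasure \<nu> {..- (1 / real (Suc n))} = 0" by (simp add: emeasure_eq_measure)
    then show "AE x in \<nu>. - (1 / real (Suc n)) < x" by (intro AE_I[of _ _ "{..- (1 / real (Suc n))}"]) auto
  qed
  then show ?thesis
  proof eventually_elim
    case (elim x)
    show ?case
    proof (rule ccontr)
      assume "\<not> x \<ge> 0"
      then obtain n where "inverse (of_nat (Suc n)) < - x" using reals_Archimedean[of "- x"] by auto
      with elim[rule_format, of n] show False by (simp add: inverse_eq_divide)
    qed
  qed
qed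

text \<open>
  For \<open>\<rho> = 1\<close> the law lives on the nonnegative half-line, so its Cauchy transform converges at points approaching
  \<open>- y\<close> from above. In the limit the angle tends to \<open>0\<close>, and the polar equation becomes the real equation of the ray.
\<close>

lemma free_stable_negative_axis:
  assumes \<alpha>: "0 < \<alpha>" "\<alpha> < 1" and fs: "is_free_stable \<alpha> 1 \<nu>" and y: "y > 0"
  obtains u where "0 < u" "u < 1" "ray_param \<alpha> u = y" "integrable \<nu> (\<lambda>x. 1 / (y + x))"
    "(LINT x|\<nu>. 1 / (y + x)) = u powr (1 / \<alpha>)"
proof -
  have prob: "prob_space \<nu>" and sets_nu [measurable_cong]: "sets \<nu> = sets borel"
    using fs by (auto simp: is_free_stable_def)
  interpret prob_space \<nu> by fact
  have nonneg: "AE x in \<nu>. x \<ge> 0" by (rule free_stable_nonneg[OF \<alpha> fs])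
  define g where "g = (LINT x|\<nu>. 1 / (y + x))"
  define e where "e n = 1 / real (Suc n)" for n
  have e: "e n > 0" for n by (simp add: e_def)
  have e_lim: "e \<longlonglongrightarrow> 0" unfolding e_def using LIMSEQ_inverse_real_of_nat by (simp add: inverse_eq_divide)
  define G where "G n = cauchy_transform \<nu> (Complex (- y) (e n))" for n
  have int: "integrable \<nu> (\<lambda>x. 1 / (y + x))"
  proof (rule integrable_const_bound[where B = "1 / y"])
    show "AE x in \<nu>. norm (1 / (y + x)) \<le> 1 / y"
      using nonneg by eventually_elim (use y in \<open>simp add: frac_le\<close>)
  qed auto
  have g: "g > 0"
  proof -
    have "AE x in \<nu>. - (1 / (y + x)) < 0"
      using nonneg by eventually_elim (use y in simp)
    then have "(LINT x|\<nu>. - (1 / (y + x))) < 0"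
      using int by (intro expectation_less) auto
    then show ?thesis by (simp add: g_def)
  qed
  have "G \<longlonglongrightarrow> (LINT x|\<nu>. - complex_of_real (1 / (y + x)))"
    unfolding G_def cauchy_transform_def
  proof (rule integral_dominated_convergence[where w = "\<lambda>_. 1 / y"])
    show "AE x in \<nu>. (\<lambda>n. 1 / (Complex (- y) (e n) - complex_of_real x)) \<longlonglongrightarrow> - complex_of_real (1 / (y + x))"
      using nonneg
    proof eventually_elim
      case (elim x)
      have "(\<lambda>n. 1 / (Complex (- y) (e n) - complex_of_real x)) \<longlonglongrightarrow> 1 / (Complex (- y) 0 - complex_of_real x)"
        using elim y by (intro tendsto_intros e_lim) (auto simp: complex_eq_iff)
      also have "1 / (Complex (- y) 0 - complex_of_real x) = - complex_of_real (1 / (y + x))"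
      proof -
        have "Complex (- y) 0 - complex_of_real x = - of_real (y + x)" by (simp add: complex_eq_iff)
        then show ?thesis by (simp only:) (simp del: of_real_add)
      qed
      finally show ?case .
    qed
    show "AE x in \<nu>. norm (1 / (Complex (- y) (e n) - complex_of_real x)) \<le> 1 / y" for n
      using nonneg
    proof eventually_elim
      case (elim x)
      have "y \<le> norm (Complex (- y) (e n) - complex_of_real x)"
        using abs_Re_le_cmod[of "Complex (- y) (e n) - complex_of_real x"] elim y by simp
      then show ?case using y by (simp add: norm_divide frac_le)
    qed
  qed auto
  then have G_lim: "G \<longlonglongrightarrow> - of_real g"
    by (simp add: g_def flip: integral_complex_of_real)
  define polar where "polar n R \<delta> \<longleftrightarrow> R > 0 \<and> 0 < \<delta> \<and> \<delta> < pi \<and> G n = Complex (- cos \<delta> / R) (- sin \<delta> / R)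
    \<and> R * cos \<delta> - R powr (1 - \<alpha>) * cos ((1 - \<alpha>) * \<delta>) = y
    \<and> R * sin \<delta> - R powr (1 - \<alpha>) * sin ((1 - \<alpha>) * \<delta>) = e n" for n R \<delta>
  have "\<exists>R \<delta>. polar n R \<delta>" for n
  proof -
    obtain R \<delta> where "R > 0" "0 < \<delta>" "\<delta> < pi"
      "cauchy_transform \<nu> (Complex ((1 - 2 * 1) * y) (e n)) = Complex ((1 - 2 * 1) * cos \<delta> / R) (- sin \<delta> / R)"
      "R * cos \<delta> - R powr (1 - \<alpha>) * cos ((1 - \<alpha>) * \<delta>) = y"
      "R * sin \<delta> - R powr (1 - \<alpha>) * sin ((1 - \<alpha>) * \<delta>) = e n"
      using free_stable_boundary_polar[OF \<alpha> _ fs y e[of n]] by blast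
    then show ?thesis by (intro exI[of _ R] exI[of _ \<delta>]) (simp add: polar_def G_def)
  qed
  then obtain R \<delta> where R\<delta>: "\<And>n. polar n (R n) (\<delta> n)" by metis
  have R: "R n > 0" and \<delta>: "0 < \<delta> n" "\<delta> n < pi"
    and G_polar: "G n = Complex (- cos (\<delta> n) / R n) (- sin (\<delta> n) / R n)"
    and Re: "R n * cos (\<delta> n) - R n powr (1 - \<alpha>) * cos ((1 - \<alpha>) * \<delta> n) = y"
    and Im: "R n * sin (\<delta> n) - R n powr (1 - \<alpha>) * sin ((1 - \<alpha>) * \<delta> n) = e n" for n
    using R\<delta>[of n] by (simp_all add: polar_def)
  note bounds = boundary_angle_bounds[OF \<alpha> y e R \<delta> Im Re]
  have cos_ge: "1 - (e n / y)\<^sup>2 \<le> cos (\<delta> n)" for n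
  proof -
    have "(sin (\<delta> n))\<^sup>2 \<le> (e n / y)\<^sup>2"
      using sin_gt_zero[OF \<delta>, of n] by (intro power_mono bounds(1)) simp
    moreover have "(cos (\<delta> n))\<^sup>2 \<le> cos (\<delta> n)"
      using bounds(2)[of n] by (simp add: power2_eq_square mult_le_cancel_right1 not_less)
    ultimately show ?thesis unfolding cos_squared_eq by simp
  qed
  have lower_lim: "(\<lambda>n. 1 - (e n / y)\<^sup>2) \<longlonglongrightarrow> 1"
    using y by (auto intro!: tendsto_eq_intros e_lim)
  have cos1: "(\<lambda>n. cos (\<delta> n)) \<longlonglongrightarrow> 1"
    by (rule tendsto_sandwich[OF _ _ lower_lim tendsto_const]) (use cos_ge in auto)
  have cos2: "(\<lambda>n. cos ((1 - \<alpha>) * \<delta> n)) \<longlonglongrightarrow> 1"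
  proof (rule tendsto_sandwich[OF _ _ cos1 tendsto_const])
    have "cos (\<delta> n) \<le> cos ((1 - \<alpha>) * \<delta> n)" for n
      using \<alpha> \<delta>[of n] by (intro cos_monotone_0_pi_le) (auto simp: mult_le_cancel_right1)
    then show "\<forall>\<^sub>F n in sequentially. cos (\<delta> n) \<le> cos ((1 - \<alpha>) * \<delta> n)" by simp
  qed auto
  have norm_G: "norm (G n) = 1 / R n" for n
  proof -
    have "(norm (G n))\<^sup>2 = ((cos (\<delta> n))\<^sup>2 + (sin (\<delta> n))\<^sup>2) / (R n)\<^sup>2"
      unfolding G_polar cmod_power2 by (simp add: power_divide add_divide_distrib del: sin_cos_squared_add2)
    then have "(norm (G n))\<^sup>2 = (1 / R n)\<^sup>2"
      unfolding sin_cos_squared_add2 by (simp add: power_divide)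
    then show ?thesis using R[of n] by (simp add: power2_eq_iff_nonneg)
  qed
  have "(\<lambda>n. 1 / R n) \<longlonglongrightarrow> g"
    using tendsto_norm[OF G_lim] g unfolding norm_G by simp
  then have "(\<lambda>n. inverse (1 / R n)) \<longlonglongrightarrow> inverse g"
    using g by (intro tendsto_inverse) auto
  then have R_lim: "R \<longlonglongrightarrow> 1 / g" by (simp add: divide_inverse)
  have "(\<lambda>n. R n * cos (\<delta> n) - R n powr (1 - \<alpha>) * cos ((1 - \<alpha>) * \<delta> n)) \<longlonglongrightarrow> 1 / g * 1 - (1 / g) powr (1 - \<alpha>) * 1"
    using g by (intro tendsto_intros R_lim cos1 cos2) auto
  then have "1 / g * 1 - (1 / g) powr (1 - \<alpha>) * 1 = y"
    unfolding Re by (rule LIMSEQ_unique[OF _ tendsto_const])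
  then have "1 / g - (1 / g) powr (1 - \<alpha>) = y" by simp
  moreover have "1 / g > 0" using g by simp
  ultimately obtain u where "0 < u" "u < 1" "ray_param \<alpha> u = y" "u powr (1 / \<alpha>) = 1 / (1 / g)"
    using ray_param_of_modulus[OF \<alpha>(1) _ _ y] by blast
  then show ?thesis using that int by (simp add: g_def)
qed

section \<open>The moment formula\<close>

lemma free_stable_moment_one:
  assumes \<alpha>: "0 < \<alpha>" "\<alpha> < 1" and fs: "is_free_stable \<alpha> 1 \<nu>" and s: "-1 < s" "s < 0"
  shows "has_bochner_integral \<nu> (\<lambda>x. indicator {0<..} x * x powr s) (moment_formula \<alpha> 1 s)"
  unfolding moment_formula_def
proof (rule mellin_from_ray[where c = 1])
  have prob: "prob_space \<nu>" and sets_nu [measurable_cong]: "sets \<nu> = sets borel"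
    using fs by (auto simp: is_free_stable_def)
  show "prob_space \<nu>" "sets \<nu> = sets borel" "0 < \<alpha>" "0 < (1::real)" "(1::real) \<le> 1" "-1 < s" "s < 0" "0 < (1::real)"
    using prob sets_nu \<alpha> s by auto
  have nonneg: "AE x in \<nu>. x \<ge> 0" by (rule free_stable_nonneg[OF \<alpha> fs])
  have "cis (- pi) = -1" by (simp add: complex_eq_iff)
  then have kernel: "of_real y - of_real x * cis (- pi * 1) = complex_of_real (y + x)" for x y by simp
  show "AE x in \<nu>. \<forall>y>0. 1 * (y + \<bar>x\<bar>) \<le> norm (of_real y - of_real x * cis (- pi * 1))"
    unfolding kernel using nonneg by eventually_elim (simp del: of_real_add)
  show "\<exists>u>0. u < 1 \<and> ray_param \<alpha> u = y" if "0 < y" for y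
    using free_stable_negative_axis[OF \<alpha> fs that] by blast
  fix u :: real assume u: "0 < u" "u < 1"
  define y where "y = ray_param \<alpha> u"
  have y: "y > 0" unfolding y_def by (rule ray_param_pos[OF u])
  obtain v where v: "0 < v" "v < 1" "ray_param \<alpha> v = y" and int: "integrable \<nu> (\<lambda>x. 1 / (y + x))"
    and val: "(LINT x|\<nu>. 1 / (y + x)) = v powr (1 / \<alpha>)"
    using free_stable_negative_axis[OF \<alpha> fs y] by blast
  have "v = u" using inj_on_ray_param[OF \<alpha>(1)] u v by (auto dest: inj_onD simp: y_def)
  have "(LINT x|\<nu>. 1 / complex_of_real (y + x)) = (LINT x|\<nu>. complex_of_real (1 / (y + x)))" by simp
  also have "\<dots> = of_real (u powr (1 / \<alpha>))" unfolding integral_complex_of_real val \<open>v = u\<close> ..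
  finally show "(LINT x|\<nu>. 1 / (of_real (ray_param \<alpha> u) - of_real x * cis (- pi * 1))) = of_real (u powr (1 / \<alpha>))"
    unfolding kernel y_def .
  have "(\<integral>\<^sup>+x. ennreal (y / (norm (complex_of_real (y + x)))\<^sup>2) \<partial>\<nu>) \<le> (\<integral>\<^sup>+x. ennreal (1 / (y + x)) \<partial>\<nu>)"
  proof (rule nn_integral_mono_AE)
    show "AE x in \<nu>. ennreal (y / (norm (complex_of_real (y + x)))\<^sup>2) \<le> ennreal (1 / (y + x))"
      using nonneg
    proof eventually_elim
      case (elim x)
      have "y / (y + x)\<^sup>2 \<le> (y + x) / (y + x)\<^sup>2" using elim y by (intro divide_right_mono) auto
      also have "\<dots> = 1 / (y + x)" using elim y by (simp add: power2_eq_square)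
      finally show ?case unfolding norm_of_real by (simp add: ennreal_leI)
    qed
  qed
  also have "\<dots> = ennreal (u powr (1 / \<alpha>))"
    unfolding \<open>v = u\<close>[symmetric] val[symmetric]
    by (rule nn_integral_eq_integral[OF int]) (use nonneg y in \<open>auto elim!: eventually_mono\<close>)
  finally show "(\<integral>\<^sup>+x. ennreal (ray_param \<alpha> u / (norm (of_real (ray_param \<alpha> u) - of_real x * cis (- pi * 1)))\<^sup>2) \<partial>\<nu>) \<le> ennreal (u powr (1 / \<alpha>))"
    unfolding kernel y_def .
qed

lemma free_stable_moment_neg:
  assumes adm: "(\<alpha>, \<rho>) \<in> admissible" and fs: "is_free_stable \<alpha> \<rho> \<nu>" and s: "-1 < s" "s < 0"
  shows "has_bochner_integral \<nu> (\<lambda>x. indicator {0<..} x * x powr s) (moment_formula \<alpha> \<rho> s)"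
proof -
  consider "0 < \<rho>" "\<rho> < 1" | "0 < \<alpha>" "\<alpha> < 1" "\<rho> = 0" | "0 < \<alpha>" "\<alpha> < 1" "\<rho> = 1"
  proof -
    have "0 < \<rho> \<and> \<rho> < 1" if "\<alpha> > 1" "1 - inverse \<alpha> \<le> \<rho>" "\<rho> \<le> inverse \<alpha>"
      using that inverse_less_1_iff[of \<alpha>] by auto
    then show ?thesis using adm that by (fastforce simp: admissible_def)
  qed
  then show ?thesis
  proof cases
    case 1
    then show ?thesis by (rule free_stable_moment_interior[OF adm _ _ fs s])
  next
    case 2
    have [measurable_cong]: "sets \<nu> = sets borel" using fs by (simp add: is_free_stable_def)
    have "AE x in \<nu>. indicator {0<..} x * x powr s = 0"
      using free_stable_nonpos[OF 2(1,2) fs[unfolded 2(3)]] by eventually_elim (simp add: indicator_def)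
    then have "has_bochner_integral \<nu> (\<lambda>x. indicator {0<..} x * x powr s) 0 \<longleftrightarrow> has_bochner_integral \<nu> (\<lambda>x. 0::real) 0"
      by (intro has_bochner_integral_cong_AE) auto
    then show ?thesis by (simp add: moment_formula_def 2(3) has_bochner_integral_zero)
  next
    case 3
    then show ?thesis using free_stable_moment_one fs s by blast
  qed
qed

text \<open>
  The moment formula with its removable singularity at \<open>0\<close> filled in: \<open>sin (\<pi>\<rho>s) Gamma s\<close> is written as
  \<open>sin (\<pi>\<rho>s) / s * Gamma (1 + s)\<close>. Writing the
  denominator with the entire function \<open>rGamma\<close> makes holomorphy on the strip immediate.
\<close>

definition moment_extension :: "real \<Rightarrow> real \<Rightarrow> complex \<Rightarrow> complex" where
  "moment_extension \<alpha> \<rho> z = 1 / of_real pi * (if z = 0 then of_real (pi * \<rho>) else sin (of_real (pi * \<rho>) * z) / z)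
     * (Gamma (1 + z) * Gamma (1 - z / of_real \<alpha>) * rGamma (2 + z - z / of_real \<alpha>))"

lemma holomorphic_moment_extension:
  assumes \<alpha>: "0 < \<alpha>"
  shows "moment_extension \<alpha> \<rho> holomorphic_on {z. -1 < Re z \<and> Re z < \<alpha>}"
proof -
  have "deriv (\<lambda>z. sin (of_real (pi * \<rho>) * z)) 0 = complex_of_real (pi * \<rho>)"
    by (rule DERIV_imp_deriv) (auto intro!: derivative_eq_intros)
  then have eq: "(\<lambda>z. if z = 0 then complex_of_real (pi * \<rho>) else sin (of_real (pi * \<rho>) * z) / z)
      = (\<lambda>z. if z = 0 then deriv (\<lambda>z. sin (of_real (pi * \<rho>) * z)) 0
              else (sin (of_real (pi * \<rho>) * z) - sin (of_real (pi * \<rho>) * 0)) / (z - 0))"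
    by (auto simp: fun_eq_iff)
  have sinc: "(\<lambda>z. if z = 0 then complex_of_real (pi * \<rho>) else sin (of_real (pi * \<rho>) * z) / z)
      holomorphic_on {z. -1 < Re z \<and> Re z < \<alpha>}"
    unfolding eq
    by (rule holomorphic_on_subset[OF pole_lemma_open[of _ UNIV]]) (auto intro!: holomorphic_intros)
  have "z \<notin> \<int>\<^sub>\<le>\<^sub>0" if "Re z > 0" for z
    using that by (auto elim!: nonpos_Ints_cases)
  then show ?thesis
    unfolding moment_extension_def[abs_def] using \<alpha>
    by (intro holomorphic_intros sinc) (auto simp: divide_less_eq)
qed

lemma moment_extension_of_real:
  assumes \<alpha>: "0 < \<alpha>" and s: "-1 < s" "s < \<alpha>"
  shows "moment_extension \<alpha> \<rho> (of_real s) = of_real (if s = 0 then \<rho> else moment_formula \<alpha> \<rho> s)"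
proof (cases "s = 0")
  case True
  then show ?thesis
    using Gamma_fact[of 1, where 'a = complex] by (simp add: moment_extension_def rGamma_inverse_Gamma)
next
  case False
  have "s \<notin> \<int>\<^sub>\<le>\<^sub>0"
  proof
    assume "s \<in> \<int>\<^sub>\<le>\<^sub>0"
    then obtain n where "s = of_int n" "n \<le> 0" by (auto elim!: nonpos_Ints_cases)
    with s False have "-1 < n" "n < 0" by simp_all
    then show False by simp
  qed
  then have "Gamma (1 + s) = s * Gamma s" using Gamma_plus1[of s] by (simp add: add.commute)
  then have "moment_formula \<alpha> \<rho> s = 1 / pi * (sin (pi * \<rho> * s) / s) * (Gamma (1 + s) * Gamma (1 - s / \<alpha>) * rGamma (2 + s - s / \<alpha>))"
    using False by (simp add: moment_formula_def rGamma_inverse_Gamma divide_inverse)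
  then have "complex_of_real (moment_formula \<alpha> \<rho> s) = moment_extension \<alpha> \<rho> (of_real s)"
    using False unfolding moment_extension_def
    by (simp add: sin_of_real[symmetric] Gamma_complex_of_real[symmetric] rGamma_complex_of_real[symmetric])
  then show ?thesis using False by simp
qed

lemma moment_formula_limit:
  assumes \<alpha>: "0 < \<alpha>"
  shows "(moment_formula \<alpha> \<rho> \<longlongrightarrow> \<rho>) (at 0)"
proof -
  have "continuous_on {z. -1 < Re z \<and> Re z < \<alpha>} (moment_extension \<alpha> \<rho>)"
    using holomorphic_moment_extension[OF \<alpha>] by (rule holomorphic_on_imp_continuous_on)
  moreover have "open {z. -1 < Re z \<and> Re z < \<alpha>}"
    by (intro open_Collect_conj open_halfspace_Re_gt open_halfspace_Re_lt)
  ultimately have "isCont (moment_extension \<alpha> \<rho>) (of_real 0)"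
    using \<alpha> by (subst (asm) continuous_on_eq_continuous_at) auto
  then have "isCont (\<lambda>s. Re (moment_extension \<alpha> \<rho> (of_real s))) 0"
    by (intro continuous_intros isCont_o2[of _ of_real]) auto
  then have "((\<lambda>s. Re (moment_extension \<alpha> \<rho> (of_real s))) \<longlongrightarrow> \<rho>) (at 0)"
    using moment_extension_of_real[of \<alpha> 0 \<rho>] \<alpha> by (simp add: isCont_def)
  then show ?thesis
  proof (rule Lim_transform_eventually)
    show "\<forall>\<^sub>F s in at 0. Re (moment_extension \<alpha> \<rho> (of_real s)) = moment_formula \<alpha> \<rho> s"
      unfolding eventually_at
    proof (intro exI[of _ "min 1 \<alpha>"] conjI ballI impI)
      fix s :: real assume "s \<noteq> 0 \<and> dist s 0 < min 1 \<alpha>"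
      then show "Re (moment_extension \<alpha> \<rho> (of_real s)) = moment_formula \<alpha> \<rho> s"
        using moment_extension_of_real[OF \<alpha>, of s \<rho>] by (simp add: abs_less_iff)
    qed (use \<alpha> in auto)
  qed
qed

text \<open>
  With \<open>\<phi> = ln\<close> and the indicator of the positive half-line as weight, the moment is a Laplace transform; its
  values on \<open>(-1, 0)\<close> determine it on the whole interval.
\<close>

lemma free_stable_moment:
  assumes adm: "(\<alpha>, \<rho>) \<in> admissible" and fs: "is_free_stable \<alpha> \<rho> \<nu>" and s: "-1 < s" "s < \<alpha>"
  shows "has_bochner_integral \<nu> (\<lambda>x. indicator {0<..} x * x powr s) (if s = 0 then \<rho> else moment_formula \<alpha> \<rho> s)"
proof -
  have \<alpha>: "0 < \<alpha>" using adm by (auto simp: admissible_def)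
  have [measurable_cong]: "sets \<nu> = sets borel" using fs by (simp add: is_free_stable_def)
  have exp_form: "indicator {0<..} x * x powr t = indicator {0<..} x * exp (t * ln x)" for x t :: real
    by (simp add: indicator_def powr_def)
  show ?thesis
    unfolding exp_form
  proof (rule laplace_transform_extension[where f = "moment_extension \<alpha> \<rho>" and a = "-1" and b = \<alpha> and c = 0])
    show "has_bochner_integral \<nu> (\<lambda>x. indicator {0<..} x * exp (t * ln x)) (if t = 0 then \<rho> else moment_formula \<alpha> \<rho> t)"
      if "-1 < t" "t < 0" for t
      using free_stable_moment_neg[OF adm fs that] that unfolding exp_form by simp
  qed (use \<alpha> s holomorphic_moment_extension[OF \<alpha>] moment_extension_of_real[OF \<alpha>] in \<open>auto simp: indicator_def\<close>)
qed

theorem theorem1: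
  fixes \<alpha> \<rho> s :: real and M :: "'a measure" and X :: "'a \<Rightarrow> real"
  assumes "(\<alpha>, \<rho>) \<in> admissible"
    and "prob_space M"
    and "X \<in> borel_measurable M"
    and "is_free_stable \<alpha> \<rho> (distr M borel X)"
    and "-1 < s" and "s < \<alpha>"
  shows "has_bochner_integral M
           (\<lambda>\<omega>. X \<omega> powr s * indicator {\<omega>. X \<omega> > 0} \<omega>)
           (if s = 0 then Lim (at 0) (moment_formula \<alpha> \<rho>) else moment_formula \<alpha> \<rho> s)"
proof -
  have \<alpha>: "0 < \<alpha>" using assms(1) by (auto simp: admissible_def)
  have "Lim (at 0) (moment_formula \<alpha> \<rho>) = \<rho>"
    by (rule tendsto_Lim[OF _ moment_formula_limit[OF \<alpha>]]) simp
  moreover have "has_bochner_integral M (\<lambda>\<omega>. indicator {0<..} (X \<omega>) * X \<omega> powr s) (if s = 0 then \<rho> else moment_formula \<alpha> \<rho> s)"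
    using free_stable_moment[OF assms(1,4-6)] assms(3)
    by (simp add: has_bochner_integral_iff integrable_distr_eq integral_distr)
  moreover have "indicator {0<..} (X \<omega>) * X \<omega> powr s = X \<omega> powr s * indicator {\<omega>. X \<omega> > 0} \<omega>" for \<omega>
    by (simp add: indicator_def)
  ultimately show ?thesis by (simp only:)
qed

end
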